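(* Let $q\ge5$ be odd. The Un$\Gamma$-lines form two $G_q$-orbits of size $\frac12(q^3-q)$, and they can be labelled $\mathcal O_1,\mathcal O_2$ so that, writing $\Pi_{\pi,j}$ for the number of $\pi$-planes through any line of $\mathcal O_j$ and $\Lambda_{j,\pi}$ for the number of lines of $\mathcal O_j$ in a $\pi$-plane: $\Pi_{\pi,j}=\Lambda_{j,\pi}=0$ for $\pi\in\{\Gamma,0_{\mathcal C}\}$, $j=1,2$; $\Pi_{2_{\mathcal C},1}=1$; $\Pi_{2_{\mathcal C},2}=3$; $\Lambda_{1,2_{\mathcal C}}=\Pi_{3_{\mathcal C},1}=\Pi_{\overline{1_{\mathcal C}},2}=\Lambda_{2,\overline{1_{\mathcal C}}}=\frac12(q-1)$; $\Pi_{3_{\mathcal C},2}=\frac12(q-3)$; $\Lambda_{2,3_{\mathcal C}}=\frac32(q-3)$; $\Lambda_{2,2_{\mathcal C}}=\Lambda_{1,3_{\mathcal C}}=\frac32(q-1)$; $\Pi_{\overline{1_{\mathcal C}},1}=\Lambda_{1,\overline{1_{\mathcal C}}}=\frac12(q+1)$.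
   Context: Let $\mathrm{PG}(3,q)$ have points $\mathbf{P}(x_0,x_1,x_2,x_3)$; put $P(t)=\mathbf{P}(t^3,t^2,t,1)$ ($t\in\mathbb{F}_q$), $P(\infty)=\mathbf{P}(1,0,0,0)$, $\mathcal{C}=\{P(t):t\in\mathbb{F}_q\cup\{\infty\}\}$ the twisted cubic, $G_q$ the group of projectivities fixing $\mathcal C$. Write $\boldsymbol{\pi}(c_0,c_1,c_2,c_3)$ for the plane $c_0x_0+c_1x_1+c_2x_2+c_3x_3=0$. $\Gamma$-planes: osculating planes $\boldsymbol{\pi}(1,-3t,3t^2,-t^3)$ ($t\in\mathbb{F}_q$) and $\boldsymbol{\pi}(0,0,0,1)$. A $d_{\mathcal C}$-plane ($d\in\{0,2,3\}$) contains exactly $d$ points of $\mathcal C$; a $\overline{1_{\mathcal C}}$-plane is a non-$\Gamma$-plane with exactly one point of $\mathcal C$ (each plane type is a $G_q$-orbit for $q\ge5$). A Un$\Gamma$-line is a line meeting $\mathcal C$ in exactly one point and lying in no $\Gamma$-plane. Known fact: for odd $q\ge5$ the Un$\Gamma$-lines form exactly two $G_q$-orbits, each of size $\frac12(q^3-q)$, namely the orbits of the lines through $\mathbf{P}(0,0,0,1)$ and $\mathbf{P}(1,0,1,0)$, resp. through $\mathbf{P}(0,0,0,1)$ and $\mathbf{P}(1,0,\rho,0)$ with $\rho$ a non-square in $\mathbb{F}_q$. *)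

theory Defs
  imports "HOL-Analysis.Analysis"
begin

text \<open>
  \<open>PG(3,q)\<close> is modelled by the subspaces of \<open>'a ^ 4\<close>, where \<open>'a\<close> is a finite field with \<open>q\<close> elements.
  Points, lines and planes are the subspaces of dimension 1, 2 and 3; incidence is inclusion.
  The coordinates \<open>x\<^sub>0, x\<^sub>1, x\<^sub>2, x\<^sub>3\<close> are the components 1, 2, 3, 4 of a vector.
\<close>

type_synonym 'a subsp = "('a ^ 4) set"

definition pg_lines :: "'a::field subsp set" where
  "pg_lines = {l. vec.subspace l \<and> vec.dim l = 2}"

definition pg_planes :: "'a::field subsp set" where
  "pg_planes = {p. vec.subspace p \<and> vec.dim p = 3}"

definition pg_point :: "'a::field \<Rightarrow> 'a \<Rightarrow> 'a \<Rightarrow> 'a \<Rightarrow> 'a subsp" where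
  "pg_point x0 x1 x2 x3 = vec.span {vector [x0, x1, x2, x3]}"

definition pg_plane :: "'a::field \<Rightarrow> 'a \<Rightarrow> 'a \<Rightarrow> 'a \<Rightarrow> 'a subsp" where
  "pg_plane c0 c1 c2 c3 = {x. c0 * x $ 1 + c1 * x $ 2 + c2 * x $ 3 + c3 * x $ 4 = 0}"

definition twisted_cubic :: "'a::field subsp set" where
  "twisted_cubic = insert (pg_point 1 0 0 0) (range (\<lambda>t. pg_point (t ^ 3) (t ^ 2) t 1))"

text \<open>
  Restricting to the subspaces identifies the maps of proportional matrices, so the
  projectivities are exactly the elements of \<open>PGL(4,q)\<close>.
\<close>

definition projectivity :: "'a::field ^ 4 ^ 4 \<Rightarrow> 'a subsp \<Rightarrow> 'a subsp" where
  "projectivity A = restrict (\<lambda>S. (\<lambda>x. A *v x) ` S) {S. vec.subspace S}"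

definition cubic_group :: "('a::field subsp \<Rightarrow> 'a subsp) set" where
  "cubic_group = {projectivity A | A. invertible A \<and> projectivity A ` twisted_cubic = twisted_cubic}"

definition cubic_orbit :: "'a::field subsp \<Rightarrow> 'a subsp set" where
  "cubic_orbit S = {g S | g. g \<in> cubic_group}"

definition Gamma_planes :: "'a::field subsp set" where
  "Gamma_planes =
     insert (pg_plane 0 0 0 1) (range (\<lambda>t. pg_plane 1 (- 3 * t) (3 * t ^ 2) (- (t ^ 3))))"

definition cubic_points_in :: "'a::field subsp \<Rightarrow> 'a subsp set" where
  "cubic_points_in S = {p \<in> twisted_cubic. p \<subseteq> S}"

definition d_planes :: "nat \<Rightarrow> 'a::{field,finite} subsp set" where
  "d_planes d = {p \<in> pg_planes. card (cubic_points_in p) = d}"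

definition one_bar_planes :: "'a::{field,finite} subsp set" where
  "one_bar_planes = {p \<in> pg_planes. p \<notin> Gamma_planes \<and> card (cubic_points_in p) = 1}"

definition UnGamma_lines :: "'a::{field,finite} subsp set" where
  "UnGamma_lines =
     {l \<in> pg_lines. card (cubic_points_in l) = 1 \<and> (\<forall>p\<in>Gamma_planes. \<not> l \<subseteq> p)}"

text \<open>
  The numbers \<open>\<Pi>\<close> and \<open>\<Lambda>\<close> as relations, since they are independent of the chosen line or plane
  only in particular cases: \<open>has_Pi P L n\<close> says that every line of \<open>L\<close> lies in exactly \<open>n\<close> planes
  of \<open>P\<close>, and \<open>has_Lambda L P n\<close> that every plane of \<open>P\<close> contains exactly \<open>n\<close> lines of \<open>L\<close>.
\<close>

definition has_Pi :: "'a::{field,finite} subsp set \<Rightarrow> 'a subsp set \<Rightarrow> real \<Rightarrow> bool" where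
  "has_Pi P L n \<longleftrightarrow> (\<forall>l\<in>L. real (card {p \<in> P. l \<subseteq> p}) = n)"

definition has_Lambda :: "'a::{field,finite} subsp set \<Rightarrow> 'a subsp set \<Rightarrow> real \<Rightarrow> bool" where
  "has_Lambda L P n \<longleftrightarrow> (\<forall>p\<in>P. real (card {l \<in> L. l \<subseteq> p}) = n)"

end

theory Submission
  imports Defs
begin

text \<open>
  Projecting from \<open>P(\<infinity>)\<close> turns the other points of the cubic into the affine points
  \<open>(t\<^sup>2, t)\<close> of a conic and the Un\<open>\<Gamma>\<close>-lines through \<open>P(\<infinity>)\<close> into the affine points
  \<open>(a, b)\<close> off the conic. Whether \<open>b\<^sup>2 - a\<close> is a square tells the external from the internal
  points, and this gives the two orbits: translations and scalings of \<open>t\<close> act transitively on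
  each class, while the two classes have different numbers of \<open>2\<^sub>C\<close>-planes through a line
  (three and one). All counts reduce to the number of \<open>x\<close> for which \<open>x\<^sup>2 - D\<close> is a square,
  that is, to counting points on the hyperbola \<open>x\<^sup>2 - y\<^sup>2 = D\<close>.

  The structure of \<open>G\<^sub>q\<close> is not needed: the osculating planes are characterised by incidences
  with the cubic, so every projectivity that fixes the cubic permutes them.
\<close>

subsection \<open>Linear algebra in coordinates\<close>

text \<open>A plane through \<open>inf_point\<close> is encoded by a polynomial
  \<open>c1 * t ^ 2 + c2 * t + c3\<close>, whose roots are its further points of the cubic; if it is
  monic, the discriminant \<open>c ^ 2 - 4 * m\<close> decides the type of the plane. The same
  expression governs both kinds of numbers. With \<open>m\<close> fixed and \<open>c\<close>
  running, it sorts the planes through a line by type. With the plane fixed, the lines at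
  \<open>inf_point\<close> in it have \<open>b ^ 2 - a\<close> equal to the values of its
  polynomial, and completing the square turns these, up to the factor 4, into
  \<open>x ^ 2 - D\<close> with \<open>D\<close> the discriminant. Only counts at
  \<open>inf_point\<close> are computed. A Un\<Gamma>-line carries one point of the cubic, so lines
  in a plane can be counted point by point, each point being moved to \<open>inf_point\<close> by a
  group element. The first orbit of the theorem consists of the lines with \<open>b ^ 2 - a\<close>
  a nonsquare, the second of those with a nonzero square. No step divides by 3, so characteristic 3,
  where all osculating planes share a line, is covered by the same argument.\<close>

lemma vector_4 [simp]:
  "(vector [x, y, z, w] :: 'a::zero ^ 4) $ 1 = x"
  "(vector [x, y, z, w] :: 'a::zero ^ 4) $ 2 = y"
  "(vector [x, y, z, w] :: 'a::zero ^ 4) $ 3 = z"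
  "(vector [x, y, z, w] :: 'a::zero ^ 4) $ 4 = w"
  unfolding vector_def by simp_all

lemma vec4_eq_iff: "(x :: 'a ^ 4) = y \<longleftrightarrow> x $ 1 = y $ 1 \<and> x $ 2 = y $ 2 \<and> x $ 3 = y $ 3 \<and> x $ 4 = y $ 4"
  by (simp add: vec_eq_iff forall_4)

lemma matrix_vector_mult_4:
  "(A :: 'a::semiring_1 ^ 4 ^ 4) *v x =
    vector [A$1$1 * x$1 + A$1$2 * x$2 + A$1$3 * x$3 + A$1$4 * x$4,
            A$2$1 * x$1 + A$2$2 * x$2 + A$2$3 * x$3 + A$2$4 * x$4,
            A$3$1 * x$1 + A$3$2 * x$2 + A$3$3 * x$3 + A$3$4 * x$4,
            A$4$1 * x$1 + A$4$2 * x$2 + A$4$3 * x$3 + A$4$4 * x$4]"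
  by (simp add: vec4_eq_iff matrix_vector_mult_def sum_4)

lemma invertible_if_ker_trivial:
  assumes "\<And>x. A *v x = 0 \<Longrightarrow> x = 0"
  shows "invertible (A :: 'a::field ^ 'n ^ 'n)"
  using assms by (auto simp: invertible_left_inverse matrix_left_invertible_ker)

lemma vec_subspace_image:
  "vec.subspace S \<Longrightarrow> vec.subspace ((*v) (A :: 'a::field ^ 'n ^ 'n) ` S)"
  by (rule vec.linear_subspace_image) auto

lemma vec_dim_image:
  "invertible (A :: 'a::field ^ 'n ^ 'n) \<Longrightarrow> vec.dim ((*v) A ` S) = vec.dim S"
  by (rule vec.dim_image_eq) (auto intro: inj_on_subset[OF inj_matrix_vector_mult])

lemma matrix_inv_mult:
  assumes "invertible (A :: 'a::field ^ 'n ^ 'n)"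
  shows "A ** matrix_inv A = mat 1" "matrix_inv A ** A = mat 1"
proof -
  have "A ** matrix_inv A = mat 1 \<and> matrix_inv A ** A = mat 1"
    unfolding matrix_inv_def by (rule someI_ex) (use assms in \<open>simp add: invertible_def\<close>)
  then show "A ** matrix_inv A = mat 1" "matrix_inv A ** A = mat 1" by auto
qed

subsection \<open>Planes, and lines through the point at infinity\<close>

lemma vec_subspace_pg_plane: "vec.subspace (pg_plane c0 c1 c2 c3)"
  unfolding pg_plane_def vec.subspace_def
proof (intro conjI ballI allI; simp)
  fix x y :: "'a ^ 4" and k :: 'a
  assume x: "c0 * x $ 1 + c1 * x $ 2 + c2 * x $ 3 + c3 * x $ 4 = 0"
  { assume y: "c0 * y $ 1 + c1 * y $ 2 + c2 * y $ 3 + c3 * y $ 4 = 0"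
    have "c0 * (x $ 1 + y $ 1) + c1 * (x $ 2 + y $ 2) + c2 * (x $ 3 + y $ 3) + c3 * (x $ 4 + y $ 4)
      = (c0 * x $ 1 + c1 * x $ 2 + c2 * x $ 3 + c3 * x $ 4) + (c0 * y $ 1 + c1 * y $ 2 + c2 * y $ 3 + c3 * y $ 4)"
      by (simp add: algebra_simps)
    then show "c0 * (x $ 1 + y $ 1) + c1 * (x $ 2 + y $ 2) + c2 * (x $ 3 + y $ 3) + c3 * (x $ 4 + y $ 4) = 0"
      using x y by simp }
  have "c0 * (k * x $ 1) + c1 * (k * x $ 2) + c2 * (k * x $ 3) + c3 * (k * x $ 4)
    = k * (c0 * x $ 1 + c1 * x $ 2 + c2 * x $ 3 + c3 * x $ 4)"
    by (simp add: algebra_simps)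
  then show "c0 * (k * x $ 1) + c1 * (k * x $ 2) + c2 * (k * x $ 3) + c3 * (k * x $ 4) = 0"
    using x by simp
qed

text \<open>A nonzero linear form has a kernel of codimension one: any \<open>w\<close> outside the
  kernel spans the whole space together with it, because subtracting a suitable multiple of
  \<open>w\<close> makes the form vanish.\<close>

lemma vec_dim_pg_plane:
  assumes "(c0, c1, c2, c3) \<noteq> (0, 0, 0, 0 :: 'a::field)"
  shows "vec.dim (pg_plane c0 c1 c2 c3) = 3"
proof -
  let ?K = "pg_plane c0 c1 c2 c3"
  let ?f = "\<lambda>x :: 'a ^ 4. c0 * x $ 1 + c1 * x $ 2 + c2 * x $ 3 + c3 * x $ 4"
  have "\<exists>w. ?f w \<noteq> 0"
  proof (rule ccontr)
    assume "\<nexists>w. ?f w \<noteq> 0"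
    then have "?f (vector [1,0,0,0]) = 0" "?f (vector [0,1,0,0]) = 0"
      "?f (vector [0,0,1,0]) = 0" "?f (vector [0,0,0,1]) = 0" by blast+
    then show False using assms by simp
  qed
  then obtain w where w: "?f w \<noteq> 0" by blast
  have sp: "vec.span ?K = ?K"
    using vec_subspace_pg_plane by (rule vec.span_eq_iff[THEN iffD2])
  have "w \<notin> vec.span ?K"
    unfolding sp using w by (simp add: pg_plane_def)
  then have 1: "vec.dim (insert w ?K) = vec.dim ?K + 1"
    by (simp add: vec.dim_insert)
  have "x \<in> vec.span (insert w ?K)" for x
  proof -
    define k where "k = ?f x / ?f w"
    have "?f (x - k *s w) = ?f x - k * ?f w"
      by (simp add: algebra_simps)
    also have "\<dots> = 0" using w by (simp add: k_def)
    finally have "x - k *s w \<in> ?K" by (simp add: pg_plane_def)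
    then have "(x - k *s w) + k *s w \<in> vec.span (insert w ?K)"
      by (intro vec.span_add vec.span_scale vec.span_base) auto
    then show ?thesis by simp
  qed
  then have "vec.span (insert w ?K) = UNIV" by blast
  then have "vec.dim (insert w ?K) = vec.dim (UNIV :: ('a ^ 4) set)"
    by (metis vec.dim_span)
  with 1 vec_dim_card[where 'n = 4 and 'a = 'a] show ?thesis by simp
qed

lemma pg_planes_eq:
  "pg_planes = {pg_plane c0 c1 c2 c3 | c0 c1 c2 c3. (c0, c1, c2, c3) \<noteq> (0, 0, 0, 0 :: 'a::field)}"
proof (intro equalityI subsetI)
  fix p :: "'a subsp" assume "p \<in> pg_planes"
  then have p: "vec.subspace p" "vec.dim p = 3" by (auto simp: pg_planes_def)
  have "p \<noteq> UNIV" using p(2) vec_dim_card[where 'n = 4 and 'a = 'a] by auto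
  then obtain w where w: "w \<notin> p" by auto
  obtain B where B: "B \<subseteq> p" "vec.independent B" "p \<subseteq> vec.span B"
    using vec.basis_exists by metis
  have "w \<notin> vec.span B"
    using w B(1) p(1) vec.span_minimal by blast
  then have "vec.independent (insert w B)" using B(2) by (rule vec.independent_insertI)
  \<comment> \<open>The equation of \<open>p\<close> is the first row of the matrix of a map that
    kills a basis of \<open>p\<close> and sends one outside vector to the first unit vector.\<close>
  then obtain g :: "'a ^ 4 \<Rightarrow> 'a ^ 4" where g: "Vector_Spaces.linear (*s) (*s) g"
      "\<forall>x\<in>insert w B. g x = (if x = w then axis 1 1 else 0)"
    using vec.linear_independent_extend[of "insert w B" "\<lambda>x. if x = w then axis 1 1 else 0"] by blast
  have wB: "w \<notin> B" using w B(1) by blast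
  define A where "A = matrix g"
  have gA: "g x = A *v x" for x using g(1) by (simp add: A_def matrix_works)
  have "g x = 0" if "x \<in> vec.span B" for x
    by (rule vec.linear_eq_0_on_span[OF g(1) _ that]) (use g(2) wB in auto)
  then have "g x = 0" if "x \<in> p" for x using that B(3) by blast
  then have sub: "p \<subseteq> pg_plane (A$1$1) (A$1$2) (A$1$3) (A$1$4)"
    by (auto simp: gA matrix_vector_mult_4 pg_plane_def vec4_eq_iff)
  have "(A *v w) $ 1 = 1" using g(2) by (simp flip: gA)
  then have nz: "(A$1$1, A$1$2, A$1$3, A$1$4) \<noteq> (0,0,0,0)"
    by (auto simp: matrix_vector_mult_4)
  have "p = pg_plane (A$1$1) (A$1$2) (A$1$3) (A$1$4)"
    using p sub vec_subspace_pg_plane vec_dim_pg_plane[OF nz]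
    by (intro vec.subspace_dim_equal) auto
  with nz show "p \<in> {pg_plane c0 c1 c2 c3 | c0 c1 c2 c3. (c0, c1, c2, c3) \<noteq> (0, 0, 0, 0)}"
    by blast
qed (auto simp: pg_planes_def vec_subspace_pg_plane vec_dim_pg_plane)

lemma pg_point_subset_iff:
  "vec.subspace S \<Longrightarrow> pg_point x0 x1 x2 x3 \<subseteq> S \<longleftrightarrow> vector [x0, x1, x2, x3] \<in> S"
  unfolding pg_point_def using vec.span_minimal vec.span_base by blast

lemma mem_pg_plane:
  "vector [x0, x1, x2, x3] \<in> pg_plane c0 c1 c2 c3 \<longleftrightarrow> c0 * x0 + c1 * x1 + c2 * x2 + c3 * x3 = 0"
  by (simp add: pg_plane_def)

definition inf_point :: "'a::field subsp" where
  "inf_point = pg_point 1 0 0 0"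

text \<open>The line joining \<open>inf_point\<close> to the point with coordinates \<open>(0, a, b, 1)\<close>.\<close>

definition inf_line :: "'a::field \<Rightarrow> 'a \<Rightarrow> 'a subsp" where
  "inf_line a b = {x. x $ 2 = a * x $ 4 \<and> x $ 3 = b * x $ 4}"

lemma vec_subspace_inf_line: "vec.subspace (inf_line a b)"
  by (auto simp: inf_line_def vec.subspace_def algebra_simps)

lemma vec_subspace_pg_point: "vec.subspace (pg_point x0 x1 x2 x3)"
  by (simp add: pg_point_def)

lemma vec_dim_insert_pair:
  assumes "x \<noteq> 0" "y \<notin> vec.span {x :: 'a::field ^ 'n}"
  shows "vec.dim {y, x} = 2"
  using assms by (simp add: vec.dim_insert)

lemma span_pair_eq_line:
  fixes x y :: "'a::field ^ 'n"
  assumes "vec.subspace l" "vec.dim l = 2" "x \<in> l" "y \<in> l" "x \<noteq> 0" "y \<notin> vec.span {x}"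
  shows "l = vec.span {y, x}"
proof -
  have "vec.span {y, x} \<subseteq> l" using assms by (intro vec.span_minimal) auto
  moreover have "vec.dim (vec.span {y, x}) = 2" using assms by (simp add: vec.dim_insert)
  ultimately show ?thesis using assms
    by (metis vec.subspace_dim_equal vec.subspace_span order_refl)
qed

lemma inf_line_eq_span: "inf_line a b = vec.span {vector [0, a, b, 1], vector [1, 0, 0, 0]}"
proof (intro equalityI vec.span_minimal vec_subspace_inf_line subsetI)
  fix x assume "x \<in> inf_line a b"
  then have "x = x $ 4 *s vector [0, a, b, 1] + x $ 1 *s vector [1, 0, 0, 0]"
    by (simp add: inf_line_def vec4_eq_iff algebra_simps)
  then show "x \<in> vec.span {vector [0, a, b, 1], vector [1, 0, 0, 0]}"
    by (metis vec.span_add vec.span_scale vec.span_base insertI1 insertI2)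
qed (auto simp: inf_line_def)

lemma notin_span_e1: "(y :: 'a::field ^ 4) \<notin> vec.span {vector [1, 0, 0, 0]} \<longleftrightarrow> y $ 2 \<noteq> 0 \<or> y $ 3 \<noteq> 0 \<or> y $ 4 \<noteq> 0"
  by (auto simp: vec.span_singleton image_iff vec4_eq_iff)

lemma inf_line_in_pg_lines: "inf_line a b \<in> pg_lines"
proof -
  have "vec.dim {vector [0, a, b, 1], vector [1, 0, 0, 0] :: 'a ^ 4} = 2"
    by (rule vec_dim_insert_pair) (auto simp: notin_span_e1 vec4_eq_iff)
  then show ?thesis by (simp add: pg_lines_def inf_line_eq_span vec.dim_span)
qed

lemma pg_line_through_inf:
  assumes "l \<in> pg_lines" "inf_point \<subseteq> (l :: 'a::field subsp)"
  obtains r where "r \<in> l" "r \<notin> vec.span {vector [1, 0, 0, 0]}"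
    "l = vec.span {r, vector [1, 0, 0, 0]}"
proof -
  let ?e = "vector [1, 0, 0, 0] :: 'a ^ 4"
  have l: "vec.subspace l" "vec.dim l = 2" "?e \<in> l"
    using assms by (auto simp: pg_lines_def inf_point_def pg_point_subset_iff)
  have "\<not> l \<subseteq> vec.span {?e}"
  proof
    assume "l \<subseteq> vec.span {?e}"
    then have "vec.dim l \<le> vec.dim {?e}" by (metis vec.dim_mono)
    also have "\<dots> \<le> 1" by (simp add: vec.dim_insert)
    finally show False using l by simp
  qed
  then obtain r where "r \<in> l" "r \<notin> vec.span {?e}" by blast
  then show ?thesis using that span_pair_eq_line[OF l(1,2,3)] by (auto simp: vec4_eq_iff)
qed

lemma pg_line_through_inf_cases:
  assumes "l \<in> pg_lines" "inf_point \<subseteq> l"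
  shows "l \<subseteq> pg_plane 0 0 0 (1 :: 'a::field) \<or> (\<exists>a b. l = inf_line a b)"
proof (cases "l \<subseteq> pg_plane 0 0 0 1")
  case False
  then obtain v where v: "v \<in> l" "v $ 4 \<noteq> 0" by (auto simp: pg_plane_def)
  have l: "vec.subspace l" "vector [1, 0, 0, 0] \<in> l" "vec.dim l = 2"
    using assms by (auto simp: pg_lines_def inf_point_def pg_point_subset_iff)
  \<comment> \<open>The point of \<open>l\<close> normalised by scaling the last coordinate to 1 and
    removing the first one along the vector of \<open>inf_point\<close>.\<close>
  define w :: "'a ^ 4" where "w = vector [0, v$2 / v$4, v$3 / v$4, 1]"
  have "w = (1 / v$4) *s v + (- (v$1 / v$4)) *s vector [1, 0, 0, 0]"
    using v by (simp add: w_def vec4_eq_iff field_simps)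
  then have "w \<in> l" using l v by (metis vec.subspace_add vec.subspace_scale)
  then have "inf_line (v$2 / v$4) (v$3 / v$4) = l"
    using l span_pair_eq_line[of l "vector [1, 0, 0, 0]" w]
    by (auto simp: inf_line_eq_span w_def notin_span_e1 vec4_eq_iff)
  then show ?thesis by blast
qed auto

lemma inf_point_subset_inf_line: "inf_point \<subseteq> inf_line a b"
  by (simp add: inf_point_def pg_point_subset_iff[OF vec_subspace_inf_line]) (simp add: inf_line_def)

lemma inf_point_subset_pg_plane: "inf_point \<subseteq> pg_plane c0 c1 c2 c3 \<longleftrightarrow> c0 = 0"
  by (simp add: inf_point_def pg_point_subset_iff vec_subspace_pg_plane mem_pg_plane)

lemma inf_line_subset_pg_plane:
  "inf_line a b \<subseteq> pg_plane c0 c1 c2 c3 \<longleftrightarrow> c0 = 0 \<and> c1 * a + c2 * b + c3 = 0"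
proof
  assume "inf_line a b \<subseteq> pg_plane c0 c1 c2 c3"
  moreover have "vector [0, a, b, 1] \<in> inf_line a b" "vector [1, 0, 0, 0] \<in> inf_line a b"
    by (auto simp: inf_line_def)
  ultimately show "c0 = 0 \<and> c1 * a + c2 * b + c3 = 0"
    by (metis (no_types, lifting) add.right_neutral mem_pg_plane mult.right_neutral mult_zero_right subsetD add_0)
next
  assume *: "c0 = 0 \<and> c1 * a + c2 * b + c3 = 0"
  show "inf_line a b \<subseteq> pg_plane c0 c1 c2 c3"
    unfolding inf_line_eq_span using *
    by (intro vec.span_minimal vec_subspace_pg_plane) (auto simp: mem_pg_plane)
qed

lemma inf_line_eq_iff: "inf_line a b = inf_line c d \<longleftrightarrow> a = c \<and> b = d"
proof
  assume *: "inf_line a b = inf_line c d"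
  have "vector [0, a, b, 1] \<in> inf_line a b" by (auto simp: inf_line_def)
  then show "a = c \<and> b = d" unfolding * by (simp add: inf_line_def)
qed auto

lemma pg_plane_scale: "k \<noteq> 0 \<Longrightarrow> pg_plane (k * c0) (k * c1) (k * c2) (k * c3) = pg_plane c0 c1 c2 (c3 :: 'a::field)"
  by (auto simp: pg_plane_def mult.assoc simp flip: distrib_left)

subsection \<open>The group of the twisted cubic\<close>

abbreviation act :: "'a::field ^ 4 ^ 4 \<Rightarrow> 'a subsp \<Rightarrow> 'a subsp" where
  "act A S \<equiv> (*v) A ` S"

text \<open>Matrices replace the projectivities they induce, which makes products and inverses
  directly available. Orbits are unaffected, since proportional matrices act alike on
  subspaces.\<close>

definition cubic_matrices :: "('a::field ^ 4 ^ 4) set" where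
  "cubic_matrices = {A. invertible A \<and> act A ` twisted_cubic = twisted_cubic}"

lemma act_act: "act A (act B S) = act (A ** B) S"
  by (auto simp: matrix_vector_mul_assoc image_image)

lemma vec_subspace_twisted_cubic: "p \<in> twisted_cubic \<Longrightarrow> vec.subspace p"
  by (auto simp: twisted_cubic_def vec_subspace_pg_point)

text \<open>\<open>projectivity\<close> is restricted to subspaces and agrees with
  \<open>act\<close> only there, hence the assumption on \<open>S\<close>.\<close>

lemma cubic_orbit_eq:
  fixes S :: "'a::field subsp"
  assumes "vec.subspace S"
  shows "cubic_orbit S = (\<lambda>A. act A S) ` cubic_matrices"
proof -
  have "projectivity A ` twisted_cubic = act A ` twisted_cubic" for A :: "'a ^ 4 ^ 4"
    unfolding projectivity_def by (intro image_cong) (auto simp: vec_subspace_twisted_cubic)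
  then have group: "(cubic_group :: ('a subsp \<Rightarrow> 'a subsp) set) = projectivity ` cubic_matrices"
    by (auto simp: cubic_group_def cubic_matrices_def)
  have "cubic_orbit S = (\<lambda>g. g S) ` cubic_group"
    by (auto simp: cubic_orbit_def)
  also have "\<dots> = (\<lambda>A. projectivity A S) ` cubic_matrices"
    unfolding group image_image ..
  finally show ?thesis using assms by (simp add: projectivity_def)
qed

lemma cubic_matrices_mult:
  assumes "A \<in> cubic_matrices" "B \<in> cubic_matrices"
  shows "A ** B \<in> cubic_matrices"
proof -
  have "act (A ** B) ` twisted_cubic = act A ` act B ` twisted_cubic"
    unfolding image_comp by (intro image_cong) (auto simp: act_act)
  then show ?thesis using assms by (simp add: cubic_matrices_def invertible_mult)
qed

lemma act_matrix_inv:
  assumes "A \<in> cubic_matrices"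
  shows "act A (act (matrix_inv A) S) = S" "act (matrix_inv A) (act A S) = S"
  using assms by (simp_all add: cubic_matrices_def act_act matrix_inv_mult)

lemma cubic_matrices_inv:
  assumes "A \<in> cubic_matrices"
  shows "matrix_inv A \<in> cubic_matrices"
proof -
  have "act (matrix_inv A) ` act A ` twisted_cubic = twisted_cubic"
    by (subst image_comp, subst comp_def, subst act_matrix_inv[OF assms]) simp
  then show ?thesis using assms matrix_inv_mult[of A]
    by (auto simp: cubic_matrices_def invertible_def)
qed

lemma mat_1_in_cubic_matrices: "mat 1 \<in> cubic_matrices"
  by (auto simp: cubic_matrices_def invertible_def intro!: exI[of _ "mat 1"])

lemma inj_cubic_matrix: "A \<in> cubic_matrices \<Longrightarrow> inj ((*v) A)"
  by (simp add: cubic_matrices_def inj_matrix_vector_mult)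

lemma act_subset_iff: "A \<in> cubic_matrices \<Longrightarrow> act A S \<subseteq> act A T \<longleftrightarrow> S \<subseteq> T"
  by (simp add: inj_image_subset_iff inj_cubic_matrix)

lemma act_eq_iff: "A \<in> cubic_matrices \<Longrightarrow> act A S = act A T \<longleftrightarrow> S = T"
  by (simp add: inj_image_eq_iff inj_cubic_matrix)

lemma act_pg_lines: "A \<in> cubic_matrices \<Longrightarrow> l \<in> pg_lines \<Longrightarrow> act A l \<in> pg_lines"
  by (auto simp: pg_lines_def cubic_matrices_def vec_subspace_image vec_dim_image)

lemma act_pg_planes: "A \<in> cubic_matrices \<Longrightarrow> p \<in> pg_planes \<Longrightarrow> act A p \<in> pg_planes"
  by (auto simp: pg_planes_def cubic_matrices_def vec_subspace_image vec_dim_image)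

lemma cubic_points_in_act:
  assumes "A \<in> cubic_matrices"
  shows "cubic_points_in (act A S) = act A ` cubic_points_in S"
proof -
  have "twisted_cubic = act A ` twisted_cubic" using assms by (simp add: cubic_matrices_def)
  then have "cubic_points_in (act A S) = {p \<in> act A ` twisted_cubic. p \<subseteq> act A S}"
    by (simp add: cubic_points_in_def)
  also have "\<dots> = act A ` cubic_points_in S"
    using act_subset_iff[OF assms] unfolding cubic_points_in_def by blast
  finally show ?thesis .
qed

lemma card_cubic_points_in_act:
  assumes "A \<in> cubic_matrices"
  shows "card (cubic_points_in (act A S)) = card (cubic_points_in S)"
  unfolding cubic_points_in_act[OF assms]
  by (intro card_image inj_onI) (simp add: act_eq_iff[OF assms])

text \<open>Closure in one direction suffices: \<open>cubic_matrices\<close> contains inverses, so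
  \<open>cubic_invariant_act_iff\<close> follows.\<close>

definition cubic_invariant :: "'a::field subsp set \<Rightarrow> bool" where
  "cubic_invariant X \<longleftrightarrow> (\<forall>A\<in>cubic_matrices. \<forall>S\<in>X. act A S \<in> X)"

lemma cubic_invariantD: "cubic_invariant X \<Longrightarrow> A \<in> cubic_matrices \<Longrightarrow> S \<in> X \<Longrightarrow> act A S \<in> X"
  by (auto simp: cubic_invariant_def)

lemma cubic_invariant_act_iff:
  assumes "cubic_invariant X" "A \<in> cubic_matrices"
  shows "act A S \<in> X \<longleftrightarrow> S \<in> X"
  using cubic_invariantD[OF assms] cubic_invariantD[OF assms(1) cubic_matrices_inv[OF assms(2)]]
    act_matrix_inv[OF assms(2)] by metis

lemma cubic_invariant_d_planes: "cubic_invariant (d_planes d)"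
  by (auto simp: cubic_invariant_def d_planes_def act_pg_planes card_cubic_points_in_act)

text \<open>The transport principle behind every reduction to \<open>inf_point\<close>:
  \<open>act A\<close> is a bijection from the members of \<open>X\<close> with \<open>R\<close> to
  those with \<open>Q\<close>, the inverse matrix giving surjectivity.\<close>

lemma card_invariant_eq:
  assumes X: "cubic_invariant X" and A: "A \<in> cubic_matrices"
    and QR: "\<And>S. S \<in> X \<Longrightarrow> Q (act A S) \<longleftrightarrow> R S"
  shows "card {S \<in> X. Q S} = card {S \<in> X. R S}"
proof -
  have "{S \<in> X. Q S} = act A ` {S \<in> X. R S}"
  proof (intro equalityI subsetI)
    fix S assume S: "S \<in> {S \<in> X. Q S}"
    define T where "T = act (matrix_inv A) S"
    have ST: "S = act A T" by (simp only: T_def act_matrix_inv[OF A])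
    have "T \<in> X" using cubic_invariantD[OF X cubic_matrices_inv[OF A]] S by (simp only: T_def mem_Collect_eq)
    then have "T \<in> {S \<in> X. R S}" using S QR[of T] ST by simp
    then show "S \<in> act A ` {S \<in> X. R S}" using ST by (rule rev_image_eqI)
  next
    fix S assume "S \<in> act A ` {S \<in> X. R S}"
    then obtain T where "S = act A T" "T \<in> X" "R T" by (elim imageE) simp
    then show "S \<in> {S \<in> X. Q S}" using QR[of T] cubic_invariantD[OF X A] by simp
  qed
  moreover have "inj_on (act A) T" for T
    using act_eq_iff[OF A] by (auto intro: inj_onI)
  ultimately show ?thesis by (simp add: card_image)
qed

lemma cubic_orbit_self: "vec.subspace S \<Longrightarrow> S \<in> cubic_orbit S"
  by (subst cubic_orbit_eq) (auto intro!: image_eqI[of _ _ "mat 1"] mat_1_in_cubic_matrices)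

lemma cubic_orbit_invariant:
  assumes "vec.subspace S"
  shows "cubic_invariant (cubic_orbit S)"
  unfolding cubic_invariant_def cubic_orbit_eq[OF assms]
  using cubic_matrices_mult by (auto simp: act_act simp del: image_image)

lemma cubic_orbit_subset:
  assumes "cubic_invariant X" "S \<in> X" "vec.subspace S"
  shows "cubic_orbit S \<subseteq> X"
  using assms by (auto simp: cubic_orbit_eq cubic_invariant_def)

lemma cubic_orbit_act:
  assumes S: "vec.subspace S" and A: "A \<in> cubic_matrices"
  shows "cubic_orbit (act A S) = cubic_orbit S"
proof
  have S': "vec.subspace (act A S)" using S by (rule vec_subspace_image)
  show "cubic_orbit (act A S) \<subseteq> cubic_orbit S"
    by (intro cubic_orbit_subset cubic_orbit_invariant S S'
        cubic_invariantD[OF cubic_orbit_invariant A] cubic_orbit_self)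
  have "act (matrix_inv A) (act A S) \<in> cubic_orbit (act A S)"
    by (intro cubic_invariantD[OF cubic_orbit_invariant] cubic_matrices_inv cubic_orbit_self S' A)
  then show "cubic_orbit S \<subseteq> cubic_orbit (act A S)"
    by (intro cubic_orbit_subset cubic_orbit_invariant S S') (simp only: act_matrix_inv[OF A])
qed

section \<open>Parametrised points of the cubic and explicit group elements\<close>

definition cubic_point :: "'a::field \<Rightarrow> 'a subsp" where
  "cubic_point t = pg_point (t ^ 3) (t ^ 2) t 1"

lemma twisted_cubic_eq: "twisted_cubic = insert inf_point (range cubic_point)"
  by (simp add: twisted_cubic_def inf_point_def cubic_point_def [abs_def])

lemma act_pg_point:
  assumes "A *v vector [x0, x1, x2, x3] = vector [y0, y1, y2, y3]"
  shows "act A (pg_point x0 x1 x2 x3) = pg_point y0 y1 y2 y3"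
  unfolding pg_point_def by (subst vec.linear_span_image[symmetric]) (auto simp: assms)

lemma pg_point_scale: "k \<noteq> 0 \<Longrightarrow> pg_point (k * x0) (k * x1) (k * x2) (k * x3) = pg_point x0 x1 x2 (x3 :: 'a::field)"
proof -
  assume k: "k \<noteq> 0"
  have "vector [k * x0, k * x1, k * x2, k * x3] = k *s (vector [x0, x1, x2, x3] :: 'a ^ 4)"
    by (simp add: vec4_eq_iff)
  then show ?thesis using k vec.span_image_scale[of "{vector [x0, x1, x2, x3]}" "\<lambda>_. k"]
    by (simp add: pg_point_def)
qed

lemma cubic_point_subset_iff:
  "vec.subspace S \<Longrightarrow> cubic_point t \<subseteq> S \<longleftrightarrow> vector [t ^ 3, t ^ 2, t, 1] \<in> S"
  by (simp add: cubic_point_def pg_point_subset_iff)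

lemma vec_subspace_cubic_point: "vec.subspace (cubic_point t)"
  by (simp add: cubic_point_def vec_subspace_pg_point)

lemma inj_cubic_point: "inj cubic_point"
proof (rule injI)
  fix s t :: 'a assume "cubic_point s = cubic_point t"
  then have "cubic_point s \<subseteq> cubic_point t" by simp
  then have "vector [s ^ 3, s ^ 2, s, 1] \<in> cubic_point t"
    by (simp only: cubic_point_subset_iff[OF vec_subspace_cubic_point])
  then show "s = t"
    by (auto simp: cubic_point_def pg_point_def vec.span_singleton vec4_eq_iff)
qed

lemma inf_point_neq_cubic_point: "inf_point \<noteq> cubic_point t"
proof
  assume "inf_point = cubic_point t"
  then have "cubic_point t \<subseteq> inf_point" by simp
  then have "vector [t ^ 3, t ^ 2, t, 1] \<in> inf_point"
    by (subst (asm) cubic_point_subset_iff) (simp_all add: inf_point_def vec_subspace_pg_point)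
  then show False
    by (auto simp: inf_point_def pg_point_def vec.span_singleton vec4_eq_iff)
qed

lemma card_twisted_cubic: "card (twisted_cubic :: 'a::{field,finite} subsp set) = CARD('a) + 1"
  using inf_point_neq_cubic_point by (auto simp: twisted_cubic_eq card_insert_if card_image inj_cubic_point)

text \<open>Finite points are counted through their parameters, so that incidence with the cubic
  becomes a count of polynomial roots.\<close>

lemma card_cubic_points_in:
  fixes S :: "'a::{field,finite} subsp"
  shows "card (cubic_points_in S) = of_bool (inf_point \<subseteq> S) + card {t. cubic_point t \<subseteq> S}"
proof -
  have "cubic_points_in S = {p :: 'a subsp. p = inf_point \<and> inf_point \<subseteq> S} \<union> cubic_point ` {t. cubic_point t \<subseteq> S}"
    by (auto simp: cubic_points_in_def twisted_cubic_eq)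
  also have "card \<dots> = card {p :: 'a subsp. p = inf_point \<and> inf_point \<subseteq> S} + card (cubic_point ` {t. cubic_point t \<subseteq> S})"
    by (subst card_Un_disjoint) (use inf_point_neq_cubic_point in auto)
  also have "card (cubic_point ` {t. cubic_point t \<subseteq> S}) = card {t. cubic_point t \<subseteq> S}"
    by (rule card_image) (use inj_cubic_point inj_on_subset in blast)
  finally show ?thesis by (auto simp: card_insert_if)
qed

text \<open>An injective map of the finite cubic into itself is onto, so one inclusion is
  enough.\<close>

lemma cubic_matricesI:
  fixes A :: "'a::{field,finite} ^ 4 ^ 4"
  assumes inv: "invertible A" and sub: "act A ` twisted_cubic \<subseteq> twisted_cubic"
  shows "A \<in> cubic_matrices"
proof -
  have "inj (act A)"
    by (rule injI) (simp add: inj_image_eq_iff inj_matrix_vector_mult inv)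
  then have "card (act A ` twisted_cubic) = card (twisted_cubic :: 'a subsp set)"
    using card_image inj_on_subset by blast
  then have "act A ` twisted_cubic = twisted_cubic"
    using sub by (intro card_subset_eq) auto
  then show ?thesis using inv by (simp add: cubic_matrices_def)
qed

text \<open>Induced by \<open>t \<mapsto> t + s\<close>.\<close>
definition translation_matrix :: "'a::comm_ring_1 \<Rightarrow> 'a ^ 4 ^ 4" where
  "translation_matrix s = vector [vector [1, 3 * s, 3 * s ^ 2, s ^ 3], vector [0, 1, 2 * s, s ^ 2],
     vector [0, 0, 1, s], vector [0, 0, 0, 1]]"

text \<open>Induced by \<open>t \<mapsto> k t\<close>.\<close>
definition scaling_matrix :: "'a::comm_ring_1 \<Rightarrow> 'a ^ 4 ^ 4" where
  "scaling_matrix k = vector [vector [k ^ 3, 0, 0, 0], vector [0, k ^ 2, 0, 0],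
     vector [0, 0, k, 0], vector [0, 0, 0, 1]]"

text \<open>Induced by \<open>t \<mapsto> 1 / t\<close>.\<close>
definition inversion_matrix :: "'a::comm_ring_1 ^ 4 ^ 4" where
  "inversion_matrix = vector [vector [0, 0, 0, 1], vector [0, 0, 1, 0],
     vector [0, 1, 0, 0], vector [1, 0, 0, 0]]"

lemma translation_matrix_mult:
  "translation_matrix s *v x = vector [x$1 + 3 * s * x$2 + 3 * s ^ 2 * x$3 + s ^ 3 * x$4,
     x$2 + 2 * s * x$3 + s ^ 2 * x$4, x$3 + s * x$4, x$4]"
  by (simp add: translation_matrix_def matrix_vector_mult_4)

lemma scaling_matrix_mult:
  "scaling_matrix k *v x = vector [k ^ 3 * x$1, k ^ 2 * x$2, k * x$3, x$4]"
  by (simp add: scaling_matrix_def matrix_vector_mult_4)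

lemma inversion_matrix_mult:
  "inversion_matrix *v x = vector [x$4, x$3, x$2, x$1]"
  by (simp add: inversion_matrix_def matrix_vector_mult_4)

lemma act_translation_inf: "act (translation_matrix s) inf_point = inf_point"
  unfolding inf_point_def by (rule act_pg_point) (simp add: translation_matrix_mult)

lemma act_translation_cubic_point: "act (translation_matrix s) (cubic_point t) = cubic_point (t + s)"
  unfolding cubic_point_def
  by (rule act_pg_point)
    (simp add: translation_matrix_mult vec4_eq_iff power2_eq_square power3_eq_cube algebra_simps)

lemma act_scaling_inf:
  fixes k :: "'a::field"
  assumes "k \<noteq> 0"
  shows "act (scaling_matrix k) inf_point = inf_point"
proof -
  have "act (scaling_matrix k) inf_point = pg_point (k ^ 3 * 1) (k ^ 3 * 0) (k ^ 3 * 0) (k ^ 3 * 0)"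
    unfolding inf_point_def by (rule act_pg_point) (simp add: scaling_matrix_mult)
  then show ?thesis using assms by (subst (asm) pg_point_scale) (auto simp: inf_point_def)
qed

lemma act_scaling_cubic_point: "act (scaling_matrix k) (cubic_point t) = cubic_point (k * t)"
  unfolding cubic_point_def
  by (rule act_pg_point) (simp add: scaling_matrix_mult power_mult_distrib)

lemma act_inversion_inf: "act inversion_matrix inf_point = cubic_point 0"
  unfolding inf_point_def cubic_point_def by (rule act_pg_point) (simp add: inversion_matrix_mult)

lemma act_inversion_cubic_point:
  "act inversion_matrix (cubic_point t) = (if t = 0 then inf_point else cubic_point (1 / (t :: 'a::field)))"
proof (cases "t = 0")
  case True
  have "act inversion_matrix (cubic_point t) = inf_point"
    unfolding inf_point_def cubic_point_def
    by (rule act_pg_point) (simp add: inversion_matrix_mult True)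
  then show ?thesis using True by simp
next
  case False
  \<comment> \<open>The image has coordinates \<open>1, t, t ^ 2, t ^ 3\<close>; taking out the
    common factor \<open>t ^ 3\<close> exhibits the parameter \<open>1 / t\<close>.\<close>
  have "act inversion_matrix (cubic_point t) =
      pg_point (t ^ 3 * (1 / t) ^ 3) (t ^ 3 * (1 / t) ^ 2) (t ^ 3 * (1 / t)) (t ^ 3 * 1)"
    unfolding cubic_point_def by (rule act_pg_point)
      (use False in \<open>simp add: inversion_matrix_mult vec4_eq_iff power2_eq_square power3_eq_cube\<close>)
  then show ?thesis using False by (subst (asm) pg_point_scale) (auto simp: cubic_point_def)
qed

lemma translation_in_cubic_matrices: "translation_matrix (s :: 'a::{field,finite}) \<in> cubic_matrices"
proof (rule cubic_matricesI)
  show "invertible (translation_matrix s)"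
    by (rule invertible_if_ker_trivial) (auto simp: translation_matrix_mult vec4_eq_iff)
qed (auto simp: twisted_cubic_eq act_translation_inf act_translation_cubic_point)

lemma scaling_in_cubic_matrices: "k \<noteq> 0 \<Longrightarrow> scaling_matrix (k :: 'a::{field,finite}) \<in> cubic_matrices"
proof (rule cubic_matricesI)
  show "invertible (scaling_matrix k)" if "k \<noteq> 0"
    by (rule invertible_if_ker_trivial) (use that in \<open>auto simp: scaling_matrix_mult vec4_eq_iff\<close>)
qed (auto simp: twisted_cubic_eq act_scaling_inf act_scaling_cubic_point)

lemma inversion_in_cubic_matrices: "(inversion_matrix :: 'a::{field,finite} ^ 4 ^ 4) \<in> cubic_matrices"
proof (rule cubic_matricesI)
  show "invertible (inversion_matrix :: 'a ^ 4 ^ 4)"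
    by (rule invertible_if_ker_trivial) (auto simp: inversion_matrix_mult vec4_eq_iff)
  have "act inversion_matrix p \<in> twisted_cubic" if "p \<in> twisted_cubic" for p :: "'a subsp"
    using that unfolding twisted_cubic_eq
    by (elim insertE imageE; hypsubst) (simp_all add: act_inversion_inf act_inversion_cubic_point)
  then show "act inversion_matrix ` twisted_cubic \<subseteq> (twisted_cubic :: 'a subsp set)" by blast
qed

text \<open>Invertible matrices preserve dimension, so checking one inclusion on vectors determines
  the image.\<close>

lemma act_eqI:
  assumes "A \<in> cubic_matrices" "vec.subspace S" "vec.subspace T" "vec.dim T = vec.dim S"
    and "\<And>x. x \<in> S \<Longrightarrow> A *v x \<in> T"
  shows "act A S = T"
proof (rule vec.subspace_dim_equal)
  show "vec.dim T \<le> vec.dim (act A S)"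
    using assms by (simp add: cubic_matrices_def vec_dim_image)
qed (use assms in \<open>auto simp: vec_subspace_image\<close>)

lemma vec_dim_inf_line: "vec.dim (inf_line a b) = 2"
  using inf_line_in_pg_lines[of a b] by (simp add: pg_lines_def)

lemma act_translation_inf_line:
  "act (translation_matrix (s :: 'a::{field,finite})) (inf_line a b) = inf_line (a + 2 * s * b + s ^ 2) (b + s)"
  by (rule act_eqI[OF translation_in_cubic_matrices vec_subspace_inf_line vec_subspace_inf_line])
    (simp_all add: vec_dim_inf_line, simp add: inf_line_def translation_matrix_mult algebra_simps)

lemma act_scaling_inf_line:
  assumes "(k :: 'a::{field,finite}) \<noteq> 0"
  shows "act (scaling_matrix k) (inf_line a b) = inf_line (k ^ 2 * a) (k * b)"
  by (rule act_eqI[OF scaling_in_cubic_matrices[OF assms] vec_subspace_inf_line vec_subspace_inf_line])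
    (simp_all add: vec_dim_inf_line, simp add: inf_line_def scaling_matrix_mult)

lemma act_inversion_pg_plane:
  assumes "(c0, c1, c2, c3) \<noteq> (0, 0, 0, 0 :: 'a::{field,finite})"
  shows "act inversion_matrix (pg_plane c0 c1 c2 c3) = pg_plane c3 c2 c1 c0"
proof (rule act_eqI[OF inversion_in_cubic_matrices vec_subspace_pg_plane vec_subspace_pg_plane])
  show "vec.dim (pg_plane c3 c2 c1 c0) = vec.dim (pg_plane c0 c1 c2 c3)"
    using assms by (subst (1 2) vec_dim_pg_plane) auto
qed (simp add: pg_plane_def inversion_matrix_mult algebra_simps)

section \<open>Osculating planes and transitivity on the cubic\<close>

definition osc_plane :: "'a::field \<Rightarrow> 'a subsp" where
  "osc_plane t = pg_plane 1 (- 3 * t) (3 * t ^ 2) (- (t ^ 3))"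

lemma Gamma_planes_eq: "Gamma_planes = insert (pg_plane 0 0 0 1) (range osc_plane)"
  by (simp add: Gamma_planes_def osc_plane_def [abs_def])

text \<open>It induces the parameter map \<open>u \<mapsto> 1 / u + t\<close>, which carries
  infinity to 0 and then to \<open>t\<close>.\<close>

definition from_inf :: "'a::{field,finite} \<Rightarrow> 'a ^ 4 ^ 4" where
  "from_inf t = translation_matrix t ** inversion_matrix"

lemma from_inf_in_cubic_matrices: "from_inf t \<in> cubic_matrices"
  by (simp add: from_inf_def cubic_matrices_mult translation_in_cubic_matrices inversion_in_cubic_matrices)

lemma act_from_inf: "act (from_inf t) inf_point = cubic_point t"
  by (simp add: from_inf_def act_inversion_inf act_translation_cubic_point flip: act_act)

lemma act_from_inf_plane: "act (from_inf t) (pg_plane 0 0 0 1) = osc_plane (t :: 'a::{field,finite})"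
proof -
  \<comment> \<open>Inversion sends the plane at infinity to \<open>pg_plane 1 0 0 0\<close>, the
    osculating plane at parameter 0. Translating it produces the coefficients of
    \<open>(x - t) ^ 3\<close>.\<close>
  have "act (translation_matrix t) (pg_plane 1 0 0 0) = osc_plane t"
  proof (rule act_eqI)
    show "translation_matrix t *v x \<in> osc_plane t" if "x \<in> pg_plane 1 0 0 0" for x :: "'a ^ 4"
      using that by (simp add: pg_plane_def osc_plane_def translation_matrix_mult
        power2_eq_square power3_eq_cube algebra_simps)
  qed (auto simp: translation_in_cubic_matrices osc_plane_def vec_subspace_pg_plane vec_dim_pg_plane)
  then show ?thesis
    by (simp add: from_inf_def act_inversion_pg_plane flip: act_act)
qed

text \<open>The third property returns a plane identified at \<open>inf_point\<close> to
  \<open>Gamma_planes\<close> once the group element is undone.\<close>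

lemma cubic_transitive:
  assumes "P \<in> (twisted_cubic :: 'a::{field,finite} subsp set)"
  obtains A where "A \<in> cubic_matrices" "act A inf_point = P" "act A (pg_plane 0 0 0 1) \<in> Gamma_planes"
proof (cases "P = inf_point")
  case True
  show ?thesis by (rule that[OF mat_1_in_cubic_matrices]) (use True in \<open>auto simp: Gamma_planes_eq\<close>)
next
  case False
  then obtain t where "P = cubic_point t" using assms by (auto simp: twisted_cubic_eq)
  then show ?thesis
    using that[OF from_inf_in_cubic_matrices] by (auto simp: act_from_inf act_from_inf_plane Gamma_planes_eq)
qed

subsection \<open>Counting squares\<close>

text \<open>Zero is left out here and is not in \<open>nonsquares\<close> either, so that a
  vanishing discriminant forms a third case of its own.\<close>

definition squares :: "'a::field set" where
  "squares = {x. x \<noteq> 0 \<and> (\<exists>y. x = y ^ 2)}"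

definition nonsquares :: "'a::field set" where
  "nonsquares = {x. \<nexists>y. x = y ^ 2}"

lemma zero_notin_squares: "0 \<notin> squares" "0 \<notin> nonsquares"
  unfolding squares_def nonsquares_def using zero_power2 by (auto intro: sym)

lemma square_trichotomy: "x = 0 \<or> x \<in> squares \<or> x \<in> nonsquares"
  by (auto simp: squares_def nonsquares_def)

lemma squares_nonsquares_disjoint: "x \<in> squares \<Longrightarrow> x \<notin> nonsquares"
  by (auto simp: squares_def nonsquares_def)

lemma mult_square_in_squares_iff:
  assumes "k \<noteq> (0 :: 'a::field)"
  shows "k ^ 2 * x \<in> squares \<longleftrightarrow> x \<in> squares"
proof -
  have "(\<exists>y. k ^ 2 * x = y ^ 2) \<longleftrightarrow> (\<exists>y. x = y ^ 2)"
  proof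
    assume "\<exists>y. k ^ 2 * x = y ^ 2"
    then obtain y where "k ^ 2 * x = y ^ 2" ..
    then have "x = (y / k) ^ 2" using assms by (simp add: power_divide field_simps)
    then show "\<exists>y. x = y ^ 2" ..
  next
    assume "\<exists>y. x = y ^ 2"
    then obtain y where "x = y ^ 2" ..
    then have "k ^ 2 * x = (k * y) ^ 2" by (simp add: power_mult_distrib)
    then show "\<exists>y. k ^ 2 * x = y ^ 2" ..
  qed
  then show ?thesis using assms by (simp add: squares_def)
qed

lemma mult_square_in_nonsquares_iff:
  assumes "k \<noteq> (0 :: 'a::field)"
  shows "k ^ 2 * x \<in> nonsquares \<longleftrightarrow> x \<in> nonsquares"
proof -
  have "x \<in> nonsquares \<longleftrightarrow> x \<noteq> 0 \<and> x \<notin> squares" for x :: 'a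
    using square_trichotomy[of x] squares_nonsquares_disjoint[of x] zero_notin_squares by blast
  then show ?thesis using assms mult_square_in_squares_iff[OF assms, of x] by simp
qed

locale odd_order_field =
  fixes F :: "'a::{field,finite} itself"
    and q :: nat
  assumes card_UNIV [simp]: "CARD('a) = q" and odd_q: "odd q" and q_ge_5: "q \<ge> 5"
begin

text \<open>Shifting the summation variable by 1 leaves the sum over the field unchanged but adds
  \<open>of_nat q\<close>, which is therefore 0. With \<open>q\<close> odd, \<open>2 = 0\<close>
  would give \<open>1 = 0\<close>.\<close>

lemma two_neq_0: "(2 :: 'a) \<noteq> 0"
proof
  assume 2: "(2 :: 'a) = 0"
  have "(\<Sum>x\<in>UNIV. x :: 'a) = (\<Sum>x\<in>UNIV. x + 1)"
    by (rule sum.reindex_bij_witness[of _ "\<lambda>x. x + 1" "\<lambda>x. x - 1"]) auto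
  then have "of_nat q = (0 :: 'a)" by (simp add: sum.distrib)
  moreover obtain k where "q = 2 * k + 1" using odd_q by (elim oddE)
  ultimately show False using 2 by simp
qed

lemma four_neq_0: "(4 :: 'a) \<noteq> 0"
  using two_neq_0 mult_eq_0_iff[of "2 :: 'a" 2] by simp

lemma card_sqrt: "card {x :: 'a. x ^ 2 = D} = of_bool (D = 0) + 2 * of_bool (D \<in> squares)"
proof (cases "D \<in> squares")
  case True
  then obtain r where r: "D = r ^ 2" "r \<noteq> 0" by (auto simp: squares_def)
  have "r \<noteq> - r"
    using two_neq_0 r(2) by (metis mult_2 mult_eq_0_iff add.right_inverse)
  moreover have "{x. x ^ 2 = D} = {r, - r}" by (auto simp: r power2_eq_iff)
  ultimately show ?thesis using True by (auto simp: squares_def)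
next
  case False
  then have "{x. x ^ 2 = D} = (if D = 0 then {0} else {})" by (auto simp: squares_def)
  with False show ?thesis by simp
qed

lemma sum_of_bool_mem: "(\<Sum>x\<in>UNIV. of_bool (P x)) = card {x :: 'a. P x}"
  by (simp add: of_bool_def sum.If_cases)

text \<open>The fibres of squaring have one element over 0, two over each nonzero square and none
  elsewhere, and they exhaust the field.\<close>

lemma card_squares: "real (card (squares :: 'a set)) = (real q - 1) / 2"
proof -
  have "card (UNIV :: 'a set) = card (SIGMA D:(UNIV :: 'a set). {x. x ^ 2 = D})"
    by (rule bij_betw_same_card[of "\<lambda>x. (x ^ 2, x)"]) (auto simp: bij_betw_def inj_on_def)
  also have "\<dots> = (\<Sum>D\<in>(UNIV :: 'a set). of_bool (D = 0) + 2 * of_bool (D \<in> squares))"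
    by (simp add: card_sqrt)
  also have "\<dots> = 1 + 2 * card (squares :: 'a set)"
    by (simp add: sum.distrib sum_of_bool_mem flip: sum_distrib_left)
  finally show ?thesis by simp
qed

lemma partition_by_squares:
  "q = card {x :: 'a. f x = (0 :: 'a)} + card {x. f x \<in> squares} + card {x. f x \<in> nonsquares}"
proof -
  have "UNIV = ({x :: 'a. f x = 0} \<union> {x. f x \<in> squares}) \<union> {x. f x \<in> nonsquares}"
    using square_trichotomy by blast
  then have "q = card (({x :: 'a. f x = 0} \<union> {x. f x \<in> squares}) \<union> {x. f x \<in> nonsquares})"
    by simp
  also have "\<dots> = card {x :: 'a. f x = 0} + card {x. f x \<in> squares} + card {x. f x \<in> nonsquares}"
    by (subst card_Un_disjoint, simp, simp, use squares_nonsquares_disjoint zero_notin_squares in force)+ simp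
  finally show ?thesis .
qed

lemma card_nonsquares: "real (card (nonsquares :: 'a set)) = (real q - 1) / 2"
  using partition_by_squares[of "\<lambda>x. x"] card_squares by simp

text \<open>Since \<open>(x + y) * (x - y) = D\<close>, the nonzero value \<open>u = x - y\<close>
  determines \<open>x + y = D / u\<close>, and halving recovers the point.\<close>

lemma card_hyperbola:
  assumes "D \<noteq> (0 :: 'a)"
  shows "card {(x :: 'a, y). x ^ 2 - y ^ 2 = D} = q - 1"
proof -
  let ?f = "\<lambda>(x, y). x - (y :: 'a)" and ?g = "\<lambda>u. ((D / u + u) / 2, (D / u - u) / 2)"
  have "bij_betw ?f {(x, y). x ^ 2 - y ^ 2 = D} (UNIV - {0})"
  proof (rule bij_betw_byWitness[where f' = ?g])
    have f: "x + y = D / (x - y)" "x - y \<noteq> 0" if "x ^ 2 - y ^ 2 = D" for x y :: 'a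
    proof -
      have *: "(x + y) * (x - y) = D" using that by (simp add: power2_eq_square algebra_simps)
      then show "x - y \<noteq> 0" using assms by auto
      then show "x + y = D / (x - y)" using * by (simp add: eq_divide_eq)
    qed
    have half: "(a + a) / 2 = a" for a :: 'a using two_neq_0 by (simp flip: mult_2)
    show "\<forall>a\<in>{(x, y). x ^ 2 - y ^ 2 = D}. ?g (?f a) = a"
    proof
      fix a assume "a \<in> {(x, y). x ^ 2 - y ^ 2 = D}"
      then obtain x y where a: "a = (x, y)" "x ^ 2 - y ^ 2 = D" by auto
      then have "D / (x - y) = x + y" using f(1) by simp
      then show "?g (?f a) = a" using half[of x] half[of y] by (simp add: a(1))
    qed
    show "\<forall>u\<in>UNIV - {0}. ?f (?g u) = u"
      using half by (simp add: diff_divide_distrib[symmetric])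
    show "?f ` {(x, y). x ^ 2 - y ^ 2 = D} \<subseteq> UNIV - {0}" using f(2) by auto
    have "((D / u + u) / 2) ^ 2 - ((D / u - u) / 2) ^ 2 = D" if "u \<noteq> 0" for u
    proof -
      have "((D / u + u) / 2) ^ 2 - ((D / u - u) / 2) ^ 2 = (4 * (D / u * u)) / 2 ^ 2"
        by (simp add: power_divide diff_divide_distrib[symmetric] power2_sum power2_diff del: power2_eq_iff)
      then show ?thesis using that four_neq_0 by simp
    qed
    then show "?g ` (UNIV - {0}) \<subseteq> {(x, y). x ^ 2 - y ^ 2 = D}" by auto
  qed
  then show ?thesis by (simp add: bij_betw_same_card card_Diff_singleton)
qed

text \<open>The points of the hyperbola are counted by their \<open>x\<close>: above each
  \<open>x\<close> lie as many points as \<open>x ^ 2 - D\<close> has square roots.\<close>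

lemma card_shifted_squares_eq:
  assumes "D \<noteq> (0 :: 'a)"
  shows "2 * card {x. x ^ 2 - D \<in> squares} + card {x. x ^ 2 = D} = q - 1"
proof -
  have "q - 1 = card (SIGMA x:(UNIV :: 'a set). {y. y ^ 2 = x ^ 2 - D})"
    unfolding card_hyperbola[OF assms, symmetric] by (rule arg_cong[of _ _ card]) (auto simp: algebra_simps)
  also have "\<dots> = (\<Sum>x\<in>(UNIV :: 'a set). of_bool (x ^ 2 = D) + 2 * of_bool (x ^ 2 - D \<in> squares))"
    by (simp add: card_sqrt)
  also have "\<dots> = card {x. x ^ 2 = D} + 2 * card {x. x ^ 2 - D \<in> squares}"
    by (simp add: sum.distrib sum_of_bool_mem flip: sum_distrib_left)
  finally show ?thesis by simp
qed

text \<open>The class of \<open>D\<close> enters through the number of solutions of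
  \<open>x ^ 2 = D\<close>, which is 2 or 0. The nonsquare values are what remains of the
  \<open>q\<close> values of \<open>x\<close>.\<close>

lemma card_shifted_squares:
  "D \<in> squares \<Longrightarrow> real (card {x :: 'a. x ^ 2 - D \<in> squares}) = (real q - 3) / 2"
  "D \<in> squares \<Longrightarrow> real (card {x :: 'a. x ^ 2 - D \<in> nonsquares}) = (real q - 1) / 2"
  "D \<in> nonsquares \<Longrightarrow> real (card {x :: 'a. x ^ 2 - D \<in> squares}) = (real q - 1) / 2"
  "D \<in> nonsquares \<Longrightarrow> real (card {x :: 'a. x ^ 2 - D \<in> nonsquares}) = (real q + 1) / 2"
proof -
  have *: "2 * real (card {x. x ^ 2 - D \<in> squares}) + real (card {x. x ^ 2 = D}) = real q - 1"
    "real (card {x. x ^ 2 = D}) + real (card {x. x ^ 2 - D \<in> squares})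
      + real (card {x. x ^ 2 - D \<in> nonsquares}) = real q" if "D \<noteq> 0"
  proof -
    have "real (2 * card {x. x ^ 2 - D \<in> squares} + card {x. x ^ 2 = D}) = real (q - 1)"
      unfolding card_shifted_squares_eq[OF that] ..
    then show "2 * real (card {x. x ^ 2 - D \<in> squares}) + real (card {x. x ^ 2 = D}) = real q - 1"
      using q_ge_5 by (simp add: of_nat_diff)
    show "real (card {x. x ^ 2 = D}) + real (card {x. x ^ 2 - D \<in> squares})
        + real (card {x. x ^ 2 - D \<in> nonsquares}) = real q"
      using partition_by_squares[of "\<lambda>x. x ^ 2 - D"] by simp
  qed
  { assume "D \<in> squares"
    then have "D \<noteq> 0" "card {x. x ^ 2 = D} = 2" using zero_notin_squares by (auto simp: card_sqrt)
    with * show "real (card {x :: 'a. x ^ 2 - D \<in> squares}) = (real q - 3) / 2"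
      "real (card {x :: 'a. x ^ 2 - D \<in> nonsquares}) = (real q - 1) / 2" by auto }
  { assume "D \<in> nonsquares"
    then have "D \<noteq> 0" "card {x. x ^ 2 = D} = 0"
      unfolding card_sqrt using zero_notin_squares squares_nonsquares_disjoint by auto
    with * show "real (card {x :: 'a. x ^ 2 - D \<in> squares}) = (real q - 1) / 2"
      "real (card {x :: 'a. x ^ 2 - D \<in> nonsquares}) = (real q + 1) / 2" by auto }
qed

text \<open>The degenerate case \<open>D = 0\<close>, outside the reach of the hyperbola count. It
  occurs for planes with a double root.\<close>

lemma card_square_mem:
  "real (card {x :: 'a. x ^ 2 \<in> squares}) = real q - 1" "card {x :: 'a. x ^ 2 \<in> nonsquares} = 0"
proof -
  have "{x :: 'a. x ^ 2 \<in> squares} = UNIV - {0}" by (auto simp: squares_def)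
  then show "real (card {x :: 'a. x ^ 2 \<in> squares}) = real q - 1"
    using q_ge_5 by (simp add: card_Diff_singleton of_nat_diff)
  have "x ^ 2 \<notin> nonsquares" for x :: 'a unfolding nonsquares_def by blast
  then show "card {x :: 'a. x ^ 2 \<in> nonsquares} = 0" by simp
qed

section \<open>Square classes, treated uniformly, and values of quadratic polynomials\<close>

definition square_class :: "'a set \<Rightarrow> bool" where
  "square_class X \<longleftrightarrow> X = squares \<or> X = nonsquares"

lemma square_class_zero: "square_class X \<Longrightarrow> 0 \<notin> X"
  using zero_notin_squares by (auto simp: square_class_def)

lemma square_class_mult_iff: "square_class X \<Longrightarrow> k \<noteq> 0 \<Longrightarrow> k ^ 2 * x \<in> X \<longleftrightarrow> x \<in> X"
  unfolding square_class_def using mult_square_in_squares_iff mult_square_in_nonsquares_iff by blast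

lemma square_class_four_iff: "square_class X \<Longrightarrow> 4 * x \<in> X \<longleftrightarrow> x \<in> X"
  using square_class_mult_iff[OF _ two_neq_0, of X x] by simp

text \<open>Multiplying \<open>squares\<close> by \<open>m\<close> gives a subset of
  \<open>X\<close> of the same size, hence all of \<open>X\<close>. This replaces an appeal to the
  index of the squares in the multiplicative group.\<close>

lemma square_class_ratio:
  assumes X: "square_class X" and m: "m \<in> X" and y: "y \<in> X"
  obtains k where "k \<noteq> 0" "y = k ^ 2 * m"
proof -
  have m0: "m \<noteq> 0" using square_class_zero X m by blast
  have "m * s \<in> X" if s: "s \<in> squares" for s
  proof -
    obtain r where "s = r ^ 2" "r \<noteq> 0" using s by (auto simp: squares_def)
    then show ?thesis using square_class_mult_iff[OF X, of r m] m by (simp add: mult.commute)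
  qed
  then have "(*) m ` squares \<subseteq> X" by blast
  moreover have "card ((*) m ` squares) = card X"
  proof -
    have "card ((*) m ` squares) = card (squares :: 'a set)"
      by (rule card_image) (simp add: inj_on_def m0)
    moreover have "real (card X) = (real q - 1) / 2"
      using X card_squares card_nonsquares unfolding square_class_def by blast
    ultimately show ?thesis using card_squares by simp
  qed
  ultimately have "(*) m ` squares = X" by (intro card_subset_eq) auto
  then obtain s where "s \<in> squares" "y = m * s" using y by blast
  moreover from this(1) obtain k where "s = k ^ 2" "k \<noteq> 0" by (auto simp: squares_def)
  ultimately show ?thesis using that[of k] by (simp add: mult.commute)
qed

lemma quadratic_disc: "4 * (t ^ 2 + c * t + m) = (2 * t + c) ^ 2 - (c ^ 2 - 4 * (m :: 'a))"
  by (simp add: power2_eq_square algebra_simps)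

lemma card_affine: "card {t :: 'a. P (2 * t + c)} = card {x. P x}"
proof -
  have "(2 * ((x - c) / 2) + c) = x" for x
    using two_neq_0 by (metis nonzero_mult_div_cancel_left times_divide_eq_right diff_add_cancel)
  then have "bij_betw (\<lambda>t. 2 * t + c) {t. P (2 * t + c)} {x. P x}"
    using two_neq_0 by (intro bij_betw_byWitness[of _ "\<lambda>x. (x - c) / 2"]) auto
  then show ?thesis by (rule bij_betw_same_card)
qed

lemma card_quadratic_roots:
  "card {t :: 'a. t ^ 2 + c * t + m = 0} = of_bool (c ^ 2 - 4 * m = 0) + 2 * of_bool (c ^ 2 - 4 * m \<in> squares)"
proof -
  have "t ^ 2 + c * t + m = 0 \<longleftrightarrow> (2 * t + c) ^ 2 = c ^ 2 - 4 * m" for t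
  proof -
    have "t ^ 2 + c * t + m = 0 \<longleftrightarrow> 4 * (t ^ 2 + c * t + m) = 0"
      using four_neq_0 by (simp only: mult_eq_0_iff simp_thms)
    then show ?thesis unfolding quadratic_disc by simp
  qed
  then have "card {t :: 'a. t ^ 2 + c * t + m = 0} = card {x. x ^ 2 = c ^ 2 - 4 * m}"
    using card_affine[of "\<lambda>x. x ^ 2 = c ^ 2 - 4 * m" c] by simp
  then show ?thesis by (simp only: card_sqrt)
qed

text \<open>Multiplication by 4, a nonzero square, preserves the class and completes the square;
  \<open>2 * t + c\<close> then runs through the field with \<open>t\<close>.\<close>

lemma card_quadratic_mem:
  assumes "square_class X"
  shows "card {t. t ^ 2 + c * t + m \<in> X} = card {x. x ^ 2 - (c ^ 2 - 4 * m) \<in> X}"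
proof -
  have "t ^ 2 + c * t + m \<in> X \<longleftrightarrow> (2 * t + c) ^ 2 - (c ^ 2 - 4 * m) \<in> X" for t
    using square_class_four_iff[OF assms, of "t ^ 2 + c * t + m"] unfolding quadratic_disc by simp
  then show ?thesis using card_affine[of "\<lambda>x. x ^ 2 - (c ^ 2 - 4 * m) \<in> X" c] by simp
qed

end

subsection \<open>Planes through the point at infinity\<close>

text \<open>The normal forms correspond to monic quadratic, monic linear and constant polynomials in
  \<open>t\<close>. Geometrically the plane misses the tangent at \<open>inf_point\<close>, contains
  it without osculating there, or is the osculating plane.\<close>

lemma plane_through_inf_cases:
  assumes "p \<in> pg_planes" "inf_point \<subseteq> (p :: 'a::field subsp)"
  obtains c m where "p = pg_plane 0 1 c m" | m where "p = pg_plane 0 0 1 m" | "p = pg_plane 0 0 0 1"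
proof -
  obtain c1 c2 c3 where p: "p = pg_plane 0 c1 c2 c3" and nz: "(c1, c2, c3) \<noteq> (0, 0, 0)"
    using assms by (auto simp: pg_planes_eq inf_point_subset_pg_plane)
  consider "c1 \<noteq> 0" | "c1 = 0" "c2 \<noteq> 0" | "c1 = 0" "c2 = 0" "c3 \<noteq> 0" using nz by blast
  then show ?thesis
  proof cases
    case 1
    then have "p = pg_plane 0 1 (c2 / c1) (c3 / c1)"
      using pg_plane_scale[of c1 0 1 "c2 / c1" "c3 / c1"] by (simp add: p)
    then show ?thesis by (rule that(1))
  next
    case 2
    then have "p = pg_plane 0 0 1 (c3 / c2)"
      using pg_plane_scale[of c2 0 0 1 "c3 / c2"] by (simp add: p)
    then show ?thesis by (rule that(2))
  next
    case 3
    then have "p = pg_plane 0 0 0 1"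
      using pg_plane_scale[of c3 0 0 0 1] by (simp add: p)
    then show ?thesis by (rule that(3))
  qed
qed

lemma cubic_point_subset_pg_plane:
  "cubic_point t \<subseteq> pg_plane c0 c1 c2 c3 \<longleftrightarrow> c0 * t ^ 3 + c1 * t ^ 2 + c2 * t + c3 = 0"
  by (simp add: cubic_point_subset_iff vec_subspace_pg_plane mem_pg_plane)

lemma cubic_point_subset_inf_line: "cubic_point t \<subseteq> inf_line a b \<longleftrightarrow> t = b \<and> b ^ 2 = a"
  by (auto simp: cubic_point_subset_iff vec_subspace_inf_line) (auto simp: inf_line_def)

lemma card_cubic_points_in_plane:
  "card (cubic_points_in (pg_plane 0 c1 c2 (c3 :: 'a::{field,finite}))) = 1 + card {t. c1 * t ^ 2 + c2 * t + c3 = 0}"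
  by (simp add: card_cubic_points_in inf_point_subset_pg_plane cubic_point_subset_pg_plane)

lemma card_cubic_points_in_plane_0_0_1:
  "card (cubic_points_in (pg_plane 0 0 1 (m :: 'a::{field,finite}))) = 2"
  "card (cubic_points_in (pg_plane 0 0 0 (1 :: 'a::{field,finite}))) = 1"
proof -
  have "{t. t + m = 0} = {- m}" by (auto simp: eq_neg_iff_add_eq_0)
  then show "card (cubic_points_in (pg_plane 0 0 1 m)) = 2"
    by (simp add: card_cubic_points_in_plane)
qed (simp add: card_cubic_points_in_plane)

lemma pg_plane_in_pg_planes:
  "(c0, c1, c2, c3) \<noteq> (0, 0, 0, 0 :: 'a::field) \<Longrightarrow> pg_plane c0 c1 c2 c3 \<in> pg_planes"
  by (auto simp: pg_planes_def vec_subspace_pg_plane vec_dim_pg_plane)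

lemma Gamma_planes_through_inf:
  assumes "p \<in> Gamma_planes" "inf_point \<subseteq> p"
  shows "p = pg_plane 0 0 0 1"
  using assms by (auto simp: Gamma_planes_eq osc_plane_def inf_point_subset_pg_plane)

lemma pg_plane_notin_Gamma_planes: "pg_plane 0 1 c (m :: 'a::field) \<notin> Gamma_planes"
proof
  assume "pg_plane 0 1 c m \<in> Gamma_planes"
  then have "pg_plane 0 1 c m = pg_plane 0 0 0 1"
    by (rule Gamma_planes_through_inf) (simp add: inf_point_subset_pg_plane)
  then have "vector [0, 1, 0, 0] \<in> pg_plane 0 1 c m \<longleftrightarrow> vector [0, 1, 0, 0] \<in> pg_plane 0 0 0 (1 :: 'a)" by simp
  then show False by (simp add: mem_pg_plane)
qed

section \<open>Invariance of the osculating planes and of the families derived from them\<close>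

context odd_order_field begin

text \<open>The goal asks that \<open>R\<close> lie on the plane through \<open>inf_point\<close>
  and the points with parameters \<open>u\<close> and \<open>v\<close>. After projection this is a
  secant of the conic through a given point off the conic.\<close>

lemma exists_plane_two_roots:
  fixes R :: "'a ^ 4"
  assumes R: "R $ 3 \<noteq> 0 \<or> R $ 4 \<noteq> 0" and notC: "\<And>t. R $ 2 = t ^ 2 * R $ 4 \<Longrightarrow> R $ 3 \<noteq> t * R $ 4"
  obtains u v where "u \<noteq> v" "R $ 2 - (u + v) * R $ 3 + u * v * R $ 4 = 0"
proof (cases "R $ 4 = 0")
  case True
  then have R3: "R $ 3 \<noteq> 0" using R by simp
  \<comment> \<open>Only the sum \<open>u + v\<close> matters here, and it must be \<open>s\<close>.
    The chained inequalities below fix the pairs: \<open>1, - 1\<close> for \<open>s = 0\<close>,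
    and \<open>s, 0\<close> otherwise.\<close>
  define s where "s = R $ 2 / R $ 3"
  have s: "R $ 2 = s * R $ 3" using R3 by (simp add: s_def)
  show ?thesis
  proof (cases "s = 0")
    case True
    have "(1 :: 'a) \<noteq> - 1" using two_neq_0 by (metis one_add_one add.right_inverse)
    then show ?thesis by (rule that) (use True s \<open>R $ 4 = 0\<close> in simp)
  next
    case False
    then show ?thesis by (rule that) (use s \<open>R $ 4 = 0\<close> in simp)
  qed
next
  case False
  define a b where "a = R $ 2 / R $ 4" and "b = R $ 3 / R $ 4"
  have ab: "R $ 2 = a * R $ 4" "R $ 3 = b * R $ 4" using False by (simp_all add: a_def b_def)
  \<comment> \<open>The incidence condition reads \<open>(u - b) * (v - b) = e\<close>. With
    \<open>u = b + d\<close> and \<open>v = b + f\<close> it becomes \<open>d * f = e\<close>, and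
    \<open>u\<close>, \<open>v\<close> are distinct exactly when
    \<open>d ^ 2 \<noteq> e\<close>.\<close>
  define e where "e = b ^ 2 - a"
  have e: "e \<noteq> 0" using notC[of b] ab by (auto simp: e_def)
  \<comment> \<open>At most three values of \<open>d\<close> are forbidden: 0 and the square roots
    of \<open>e\<close>. This is where \<open>q\<close> must exceed 3.\<close>
  have "card {d. d ^ 2 = e} \<le> 2" using e by (simp add: card_sqrt)
  then have "card (insert 0 {d. d ^ 2 = e}) \<le> 3" by (simp add: card_insert_if)
  also have "3 < card (UNIV :: 'a set)" using q_ge_5 by simp
  finally have "insert 0 {d. d ^ 2 = e} \<noteq> UNIV" by auto
  then obtain d where "d \<notin> insert 0 {d. d ^ 2 = e}" using UNIV_eq_I by metis
  then have d: "d \<noteq> 0" "d ^ 2 \<noteq> e" by simp_all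
  define f where "f = e / d"
  have f: "d * f = e" using d(1) by (simp add: f_def)
  show ?thesis
  proof (rule that[of "b + d" "b + f"])
    show "b + d \<noteq> b + f" using d(2) f by (auto simp: power2_eq_square)
    have "a - ((b + d) + (b + f)) * b + (b + d) * (b + f) = a - b ^ 2 + d * f"
      by (simp add: power2_eq_square algebra_simps)
    also have "\<dots> = 0" by (simp add: f e_def)
    finally have "(a - ((b + d) + (b + f)) * b + (b + d) * (b + f)) * R $ 4 = 0" by simp
    then show "R $ 2 - ((b + d) + (b + f)) * R $ 3 + (b + d) * (b + f) * R $ 4 = 0"
      unfolding ab by (simp add: left_diff_distrib distrib_right mult.assoc)
  qed
qed

lemma card_cubic_points_in_two_roots:
  assumes "u \<noteq> (v :: 'a)"
  shows "card (cubic_points_in (pg_plane 0 1 (- (u + v)) (u * v))) = 3"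
proof -
  have "1 * t ^ 2 + - (u + v) * t + u * v = (t - u) * (t - v)" for t
    by (simp add: power2_eq_square algebra_simps)
  then have "{t. 1 * t ^ 2 + - (u + v) * t + u * v = 0} = {u, v}" by auto
  then show ?thesis using assms unfolding card_cubic_points_in_plane by simp
qed

text \<open>A description of the osculating planes by incidences with the cubic alone. The line
  \<open>l\<close> is the tangent at the contact point; every other line meeting the cubic in one
  point lies in a plane with three points, because \<open>q \<ge> 5\<close>.\<close>

definition osculating_planes :: "'a subsp set" where
  "osculating_planes = {p \<in> pg_planes. card (cubic_points_in p) = 1 \<and>
     (\<exists>l\<in>pg_lines. l \<subseteq> p \<and> card (cubic_points_in l) = 1 \<and> (\<forall>p'\<in>d_planes 3. \<not> l \<subseteq> p'))}"

lemma cubic_invariant_osculating_planes: "cubic_invariant osculating_planes"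
  unfolding cubic_invariant_def
proof (intro ballI)
  fix A :: "'a ^ 4 ^ 4" and p :: "'a subsp" assume A: "A \<in> cubic_matrices" and p: "p \<in> osculating_planes"
  then obtain l where l: "l \<in> pg_lines" "l \<subseteq> p" "card (cubic_points_in l) = 1" "\<forall>p'\<in>d_planes 3. \<not> l \<subseteq> p'"
    by (auto simp: osculating_planes_def)
  have "\<not> act A l \<subseteq> p'" if p': "p' \<in> d_planes 3" for p'
  proof -
    have "act (matrix_inv A) p' \<in> d_planes 3"
      using cubic_invariantD[OF cubic_invariant_d_planes cubic_matrices_inv[OF A] p'] .
    then have "\<not> l \<subseteq> act (matrix_inv A) p'" using l(4) by blast
    then show ?thesis
      using act_subset_iff[OF A, of l "act (matrix_inv A) p'"] unfolding act_matrix_inv[OF A] by simp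
  qed
  then have "\<exists>l\<in>pg_lines. l \<subseteq> act A p \<and> card (cubic_points_in l) = 1 \<and> (\<forall>p'\<in>d_planes 3. \<not> l \<subseteq> p')"
    using l by (intro bexI[of _ "act A l"] act_pg_lines[OF A])
      (simp_all add: card_cubic_points_in_act[OF A] image_mono)
  then show "act A p \<in> osculating_planes"
    using p act_pg_planes[OF A] card_cubic_points_in_act[OF A] by (simp add: osculating_planes_def)
qed

text \<open>The witnessing line passes through the only cubic point of \<open>p\<close>, here
  \<open>inf_point\<close>. Unless it is the tangent there, it lies in a plane with three points; so
  \<open>p\<close> contains the tangent, and a linear polynomial would give \<open>p\<close> a
  second point.\<close>

lemma osculating_plane_through_inf:
  assumes p: "p \<in> osculating_planes" and "inf_point \<subseteq> p"
  shows "p = pg_plane 0 0 0 1"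
proof -
  obtain l where l: "l \<in> pg_lines" "l \<subseteq> p" "card (cubic_points_in l) = 1" "\<forall>p'\<in>d_planes 3. \<not> l \<subseteq> p'"
    using p by (auto simp: osculating_planes_def)
  have "cubic_points_in l \<subseteq> cubic_points_in p" using l(2) by (auto simp: cubic_points_in_def)
  moreover have "card (cubic_points_in p) = 1" using p by (simp add: osculating_planes_def)
  ultimately have "cubic_points_in l = cubic_points_in p"
    using l(3) by (intro card_subset_eq) auto
  moreover have "inf_point \<in> cubic_points_in p"
    using assms by (simp add: cubic_points_in_def twisted_cubic_eq)
  ultimately have inf_l: "inf_point \<subseteq> l" by (auto simp: cubic_points_in_def)
  have "card {t. cubic_point t \<subseteq> l} = 0" "card {t. cubic_point t \<subseteq> p} = 0"
    using l(3) \<open>card (cubic_points_in p) = 1\<close> inf_l assms(2) by (simp_all add: card_cubic_points_in)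
  then have no_t: "\<not> cubic_point t \<subseteq> l" "\<not> cubic_point t \<subseteq> p" for t by auto
  obtain R where R: "R \<in> l" "R \<notin> vec.span {vector [1, 0, 0, 0]}" "l = vec.span {R, vector [1, 0, 0, 0]}"
    using pg_line_through_inf[OF l(1) inf_l] .
  have sub_l: "vec.subspace l" "vec.subspace p"
    using l(1) p by (auto simp: pg_lines_def osculating_planes_def pg_planes_def)
  have e1: "vector [1, 0, 0, 0] \<in> l"
    using inf_l sub_l by (simp add: inf_point_def pg_point_subset_iff)
  have R34: "R $ 3 = 0 \<and> R $ 4 = 0"
  proof (rule ccontr)
    assume "\<not> (R $ 3 = 0 \<and> R $ 4 = 0)"
    moreover have "R $ 3 \<noteq> t * R $ 4" if t: "R $ 2 = t ^ 2 * R $ 4" for t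
    proof
      assume t': "R $ 3 = t * R $ 4"
      then have R4: "R $ 4 \<noteq> 0" using R(2) t by (auto simp: notin_span_e1)
      \<comment> \<open>If \<open>R\<close> projects onto the conic, the line \<open>l\<close>
        contains a second point of the cubic.\<close>
      have "vector [t ^ 3, t ^ 2, t, 1] = (1 / R $ 4) *s R + (t ^ 3 - R $ 1 / R $ 4) *s vector [1, 0, 0, 0]"
        using R4 by (simp add: vec4_eq_iff t t')
      also have "\<dots> \<in> l" using R(1) e1 sub_l by (intro vec.subspace_add vec.subspace_scale)
      finally show False using no_t(1)[of t] sub_l by (simp add: cubic_point_subset_iff)
    qed
    ultimately obtain u v where uv: "u \<noteq> v" "R $ 2 - (u + v) * R $ 3 + u * v * R $ 4 = 0"
      using exists_plane_two_roots[of R] by blast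
    let ?p = "pg_plane 0 1 (- (u + v)) (u * v)"
    have "?p \<in> d_planes 3"
      using card_cubic_points_in_two_roots[OF uv(1)] by (simp add: d_planes_def pg_plane_in_pg_planes)
    moreover have "l \<subseteq> ?p" unfolding R(3)
      using uv(2) by (intro vec.span_minimal vec_subspace_pg_plane) (simp add: pg_plane_def algebra_simps)
    ultimately show False using l(4) by blast
  qed
  then have R2: "R $ 2 \<noteq> 0" using R(2) by (simp add: notin_span_e1)
  have "R \<in> p" using R(1) l(2) by blast
  have "p \<in> pg_planes" using p by (simp add: osculating_planes_def)
  from this assms(2) show ?thesis
  proof (cases rule: plane_through_inf_cases)
    case (1 c m)
    then have "R $ 2 = 0" using \<open>R \<in> p\<close> R34 by (simp add: pg_plane_def)
    then show ?thesis using R2 by simp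
  next
    case (2 m)
    then have "cubic_point (- m) \<subseteq> p" by (simp add: cubic_point_subset_pg_plane)
    then show ?thesis using no_t(2) by blast
  qed
qed

text \<open>The witness \<open>?l\<close> is the tangent at \<open>inf_point\<close>. Planes
  containing it have a linear or constant polynomial and therefore at most two points of the
  cubic.\<close>

lemma plane_at_inf_osculating: "pg_plane 0 0 0 1 \<in> osculating_planes"
proof -
  let ?l = "vec.span {vector [0, 1, 0, 0], vector [1, 0, 0, 0] :: 'a ^ 4}"
  have "vec.dim {vector [0, 1, 0, 0], vector [1, 0, 0, 0] :: 'a ^ 4} = 2"
    by (rule vec_dim_insert_pair) (auto simp: notin_span_e1 vec4_eq_iff)
  then have l: "?l \<in> pg_lines" by (simp add: pg_lines_def)
  have sub: "?l \<subseteq> pg_plane 0 0 0 1"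
    by (intro vec.span_minimal vec_subspace_pg_plane) (simp add: mem_pg_plane)
  have inf: "inf_point \<subseteq> ?l"
    unfolding inf_point_def pg_point_def by (rule vec.span_mono) simp
  have "cubic_points_in ?l \<subseteq> cubic_points_in (pg_plane 0 0 0 1)"
    using sub by (auto simp: cubic_points_in_def)
  then have "card (cubic_points_in ?l) \<le> card (cubic_points_in (pg_plane 0 0 0 (1 :: 'a)))"
    by (rule card_mono[rotated]) simp
  then have "card (cubic_points_in ?l) \<le> 1" by (simp only: card_cubic_points_in_plane_0_0_1)
  moreover have "card (cubic_points_in ?l) \<ge> 1" using inf by (simp add: card_cubic_points_in)
  ultimately have "card (cubic_points_in ?l) = 1" by simp
  moreover have "\<not> ?l \<subseteq> p" if p: "p \<in> d_planes 3" for p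
  proof
    assume lp: "?l \<subseteq> p"
    then have "inf_point \<subseteq> p" using inf by blast
    have "p \<in> pg_planes" using p by (simp add: d_planes_def)
    from this \<open>inf_point \<subseteq> p\<close> show False
    proof (cases rule: plane_through_inf_cases)
      case (1 c m)
      have "vector [0, 1, 0, 0] \<in> p" using lp by (auto intro: vec.span_base)
      then show ?thesis using 1 by (simp add: mem_pg_plane)
    qed (use p in \<open>auto simp: d_planes_def card_cubic_points_in_plane_0_0_1\<close>)
  qed
  ultimately show ?thesis
    using l sub card_cubic_points_in_plane_0_0_1(2) unfolding osculating_planes_def
    by (auto simp: pg_plane_in_pg_planes)
qed

lemma Gamma_planes_eq_osculating_planes: "Gamma_planes = osculating_planes"
proof (intro equalityI subsetI)
  fix p :: "'a subsp" assume "p \<in> Gamma_planes"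
  then consider "p = pg_plane 0 0 0 1" | t where "p = osc_plane t" by (auto simp: Gamma_planes_eq)
  then show "p \<in> osculating_planes"
  proof cases
    case 2
    then show ?thesis
      using cubic_invariantD[OF cubic_invariant_osculating_planes from_inf_in_cubic_matrices plane_at_inf_osculating]
      by (simp only: act_from_inf_plane)
  qed (simp add: plane_at_inf_osculating)
next
  fix p assume p: "p \<in> osculating_planes"
  then have "card (cubic_points_in p) = 1" by (simp add: osculating_planes_def)
  then obtain P where "cubic_points_in p = {P}" by (auto simp: card_1_singleton_iff)
  then have P: "P \<in> twisted_cubic" "P \<subseteq> p" by (auto simp: cubic_points_in_def)
  obtain A where A: "A \<in> cubic_matrices" "act A inf_point = P" "act A (pg_plane 0 0 0 1) \<in> Gamma_planes"
    using cubic_transitive[OF P(1)] .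
  define p' where "p' = act (matrix_inv A) p"
  have p_eq: "p = act A p'" by (simp only: p'_def act_matrix_inv[OF A(1)])
  have "p' \<in> osculating_planes"
    unfolding p'_def by (intro cubic_invariantD[OF cubic_invariant_osculating_planes] cubic_matrices_inv A p)
  moreover have "inf_point \<subseteq> p'"
    using P(2) act_subset_iff[OF A(1), of inf_point p'] by (simp add: A(2) p_eq)
  ultimately have "p' = pg_plane 0 0 0 1" by (rule osculating_plane_through_inf)
  then show "p \<in> Gamma_planes" using A(3) by (simp add: p_eq)
qed

lemma cubic_invariant_Gamma_planes: "cubic_invariant (Gamma_planes :: 'a subsp set)"
  unfolding Gamma_planes_eq_osculating_planes by (rule cubic_invariant_osculating_planes)

lemma cubic_invariant_one_bar_planes: "cubic_invariant (one_bar_planes :: 'a subsp set)"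
  unfolding cubic_invariant_def one_bar_planes_def
  by (simp add: act_pg_planes card_cubic_points_in_act cubic_invariant_act_iff[OF cubic_invariant_Gamma_planes])

lemma cubic_invariant_UnGamma_lines: "cubic_invariant (UnGamma_lines :: 'a subsp set)"
  unfolding cubic_invariant_def
proof (intro ballI)
  fix A :: "'a ^ 4 ^ 4" and l :: "'a subsp" assume A: "A \<in> cubic_matrices" and l: "l \<in> UnGamma_lines"
  have "\<not> act A l \<subseteq> p" if p: "p \<in> Gamma_planes" for p
  proof -
    have "act (matrix_inv A) p \<in> Gamma_planes"
      using cubic_invariantD[OF cubic_invariant_Gamma_planes cubic_matrices_inv[OF A] p] .
    then have "\<not> l \<subseteq> act (matrix_inv A) p" using l by (simp add: UnGamma_lines_def)
    then show ?thesis
      using act_subset_iff[OF A, of l "act (matrix_inv A) p"] unfolding act_matrix_inv[OF A] by simp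
  qed
  then show "act A l \<in> UnGamma_lines"
    using l by (simp add: UnGamma_lines_def act_pg_lines[OF A] card_cubic_points_in_act[OF A])
qed

end

subsection \<open>The lines and their orbits\<close>

text \<open>Each line of \<open>X\<close> has exactly one point of the cubic, so sorting by that
  point is a partition. \<open>S\<close> is arbitrary because both planes and the whole space are
  inserted.\<close>

lemma card_by_cubic_points:
  fixes X :: "'a::{field,finite} subsp set"
  assumes "X \<subseteq> UnGamma_lines"
  shows "card {l \<in> X. l \<subseteq> S} = (\<Sum>P\<in>cubic_points_in S. card {l \<in> X. P \<subseteq> l \<and> l \<subseteq> S})"
proof -
  have card_1: "card (cubic_points_in l) = 1" if "l \<in> X" for l
    using subsetD[OF assms that] by (simp add: UnGamma_lines_def)
  have "{l \<in> X. l \<subseteq> S} = (\<Union>P\<in>cubic_points_in S. {l \<in> X. P \<subseteq> l \<and> l \<subseteq> S})"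
  proof (intro equalityI subsetI)
    fix l assume l: "l \<in> {l \<in> X. l \<subseteq> S}"
    then obtain P where "cubic_points_in l = {P}" using card_1 by (metis card_1_singletonE mem_Collect_eq)
    then have "P \<in> cubic_points_in l" by simp
    then have "P \<in> twisted_cubic" "P \<subseteq> l" by (simp_all add: cubic_points_in_def)
    then show "l \<in> (\<Union>P\<in>cubic_points_in S. {l \<in> X. P \<subseteq> l \<and> l \<subseteq> S})"
      using l by (intro UN_I[of P]) (auto simp: cubic_points_in_def)
  next
    fix l assume "l \<in> (\<Union>P\<in>cubic_points_in S. {l \<in> X. P \<subseteq> l \<and> l \<subseteq> S})"
    then show "l \<in> {l \<in> X. l \<subseteq> S}" by (elim UN_E) simp
  qed
  also have "card \<dots> = (\<Sum>P\<in>cubic_points_in S. card {l \<in> X. P \<subseteq> l \<and> l \<subseteq> S})"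
  proof (rule card_UN_disjoint)
    have "P = Q" if "l \<in> X" "P \<in> twisted_cubic" "Q \<in> twisted_cubic" "P \<subseteq> l" "Q \<subseteq> l" for P Q l
    proof -
      have "P \<in> cubic_points_in l" "Q \<in> cubic_points_in l" using that by (auto simp: cubic_points_in_def)
      then show ?thesis using card_1[OF that(1)] by (metis card_1_singletonE singletonD)
    qed
    then show "\<forall>P\<in>cubic_points_in S. \<forall>Q\<in>cubic_points_in S. P \<noteq> Q \<longrightarrow>
        {l \<in> X. P \<subseteq> l \<and> l \<subseteq> S} \<inter> {l \<in> X. Q \<subseteq> l \<and> l \<subseteq> S} = {}"
      by (simp add: cubic_points_in_def disjoint_iff) metis
  qed simp_all
  finally show ?thesis .
qed

lemma card_invariant_flags:
  assumes "cubic_invariant X" "A \<in> cubic_matrices"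
  shows "card {l \<in> X. act A P \<subseteq> l \<and> l \<subseteq> act A S} = card {l \<in> X. P \<subseteq> l \<and> l \<subseteq> S}"
  by (rule card_invariant_eq[OF assms]) (simp add: act_subset_iff[OF assms(2)])

lemma card_invariant_planes:
  assumes "cubic_invariant X" "A \<in> cubic_matrices"
  shows "card {p \<in> X. act A l \<subseteq> p} = card {p \<in> X. l \<subseteq> p}"
  by (rule card_invariant_eq[OF assms]) (simp add: act_subset_iff[OF assms(2)])

text \<open>In the normal form of the line, a monic polynomial must have constant term
  \<open>m\<close> while \<open>c\<close> is free. The remaining plane of the pencil is
  \<open>pg_plane 0 0 1 0\<close>, the one containing the tangent at
  \<open>inf_point\<close>.\<close>

lemma card_planes_through_inf_line:
  fixes X :: "'a::{field,finite} subsp set"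
  assumes "X \<subseteq> pg_planes"
  shows "card {p \<in> X. inf_line (- m) 0 \<subseteq> p} = card {c. pg_plane 0 1 c m \<in> X} + of_bool (pg_plane 0 0 1 0 \<in> X)"
proof -
  let ?A = "(\<lambda>c. pg_plane 0 1 c m) ` {c. pg_plane 0 1 c m \<in> X}"
  let ?B = "{p :: 'a subsp. p = pg_plane 0 0 1 0 \<and> p \<in> X}"
  have "{p \<in> X. inf_line (- m) 0 \<subseteq> p} = ?A \<union> ?B" (is "?L = ?R")
  proof (intro equalityI subsetI)
    fix p assume p: "p \<in> ?L"
    then have "p \<in> pg_planes" "inf_point \<subseteq> p" using assms inf_point_subset_inf_line[of "- m" 0] by auto
    then show "p \<in> ?R"
    proof (cases rule: plane_through_inf_cases)
      case (1 c k)
      then have "k = m" using p by (simp add: inf_line_subset_pg_plane)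
      then show ?thesis using p 1 by auto
    next
      case (2 k)
      then have "k = 0" using p by (simp add: inf_line_subset_pg_plane)
      then show ?thesis using p 2 by auto
    next
      case 3
      then show ?thesis using p by (simp add: inf_line_subset_pg_plane)
    qed
  qed (elim UnE imageE CollectE; simp add: inf_line_subset_pg_plane)
  moreover have "card (?A \<union> ?B) = card ?A + card ?B"
  proof (rule card_Un_disjoint)
    have "pg_plane 0 1 c m \<noteq> pg_plane 0 0 1 (0 :: 'a)" for c
    proof
      assume "pg_plane 0 1 c m = pg_plane 0 0 1 0"
      then have "vector [0, 1, 0, 0] \<in> pg_plane 0 1 c m \<longleftrightarrow> vector [0, 1, 0, 0] \<in> pg_plane 0 0 1 (0 :: 'a)" by simp
      then show False by (simp add: mem_pg_plane)
    qed
    then show "?A \<inter> ?B = {}"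
      by blast
  qed simp_all
  moreover have "card ?A = card {c. pg_plane 0 1 c m \<in> X}"
  proof (rule card_image, rule inj_onI)
    fix c d assume eq: "pg_plane 0 1 c m = pg_plane 0 1 d m"
    \<comment> \<open>On this vector the equation with coefficient \<open>d\<close> takes the value
      \<open>c - d\<close>.\<close>
    have "vector [0, c, - 1, 0] \<in> pg_plane 0 1 c m" by (simp add: mem_pg_plane)
    then have "vector [0, c, - 1, 0] \<in> pg_plane 0 1 d m" by (simp only: eq)
    then show "c = d" by (simp add: mem_pg_plane)
  qed
  moreover have "card ?B = of_bool (pg_plane 0 0 1 0 \<in> X)"
    by (cases "pg_plane 0 0 1 0 \<in> X") (simp_all add: conj_commute cong: conj_cong)
  ultimately show ?thesis by (simp only:)
qed

context odd_order_field begin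

lemma inf_line_in_UnGamma_lines_iff: "inf_line a b \<in> UnGamma_lines \<longleftrightarrow> b ^ 2 - a \<noteq> (0 :: 'a)"
proof -
  have "\<not> inf_line a b \<subseteq> p" if "p \<in> Gamma_planes" for p
  proof
    assume sub: "inf_line a b \<subseteq> p"
    then have "inf_point \<subseteq> p" using inf_point_subset_inf_line by blast
    then have "p = pg_plane 0 0 0 1" using Gamma_planes_through_inf that by blast
    with sub show False by (simp add: inf_line_subset_pg_plane)
  qed
  moreover have "card (cubic_points_in (inf_line a b)) = 1 + card {t. t = b \<and> b ^ 2 = a}"
    by (simp add: card_cubic_points_in inf_point_subset_inf_line cubic_point_subset_inf_line)
  ultimately show ?thesis by (auto simp: UnGamma_lines_def inf_line_in_pg_lines)
qed

lemma UnGamma_line_through_inf: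
  assumes "l \<in> UnGamma_lines" "inf_point \<subseteq> (l :: 'a subsp)"
  obtains a b where "l = inf_line a b" "b ^ 2 - a \<noteq> 0"
proof -
  have l: "l \<in> pg_lines" "\<not> l \<subseteq> pg_plane 0 0 0 1"
    using assms(1) by (auto simp: UnGamma_lines_def Gamma_planes_eq)
  then obtain a b where ab: "l = inf_line a b" using pg_line_through_inf_cases assms(2) by blast
  then show ?thesis using that assms(1) inf_line_in_UnGamma_lines_iff by blast
qed

text \<open>Translating \<open>t\<close> by \<open>- b\<close> puts a Un\<open>\<Gamma>\<close>-line through \<open>P(\<infinity>)\<close> into the form
  \<open>inf_line (- m) 0\<close> with \<open>m = b\<^sup>2 - a\<close>, and scaling \<open>t\<close> multiplies \<open>m\<close> by squares.\<close>

definition line_class :: "'a set \<Rightarrow> 'a subsp set" where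
  "line_class X = {act A (inf_line (- m) 0) | A m. A \<in> cubic_matrices \<and> m \<in> X}"

lemma line_classI: "A \<in> cubic_matrices \<Longrightarrow> m \<in> X \<Longrightarrow> act A (inf_line (- m) 0) \<in> line_class X"
  unfolding line_class_def by blast

lemma line_classE:
  assumes "l \<in> line_class X"
  obtains A m where "l = act A (inf_line (- m) 0)" "A \<in> cubic_matrices" "m \<in> X"
  using assms unfolding line_class_def by blast

lemma cubic_invariant_line_class: "cubic_invariant (line_class X)"
  unfolding cubic_invariant_def
proof (intro ballI)
  fix A :: "'a ^ 4 ^ 4" and l assume A: "A \<in> cubic_matrices" and "l \<in> line_class X"
  then obtain B m where B: "l = act B (inf_line (- m) 0)" "B \<in> cubic_matrices" "m \<in> X"
    by (elim line_classE)
  show "act A l \<in> line_class X"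
    unfolding B(1) act_act by (intro line_classI cubic_matrices_mult A B)
qed

lemma inf_line_in_line_class:
  assumes "b ^ 2 - a \<in> X"
  shows "inf_line a b \<in> line_class X"
proof -
  have "inf_line a b = act (translation_matrix b) (inf_line (- (b ^ 2 - a)) 0)"
    unfolding act_translation_inf_line by simp
  then show ?thesis using line_classI[OF translation_in_cubic_matrices assms] by (simp only:)
qed

lemma line_class_subset_UnGamma_lines:
  assumes "square_class X"
  shows "line_class X \<subseteq> UnGamma_lines"
proof
  fix l assume "l \<in> line_class X"
  then obtain A m where l: "l = act A (inf_line (- m) 0)" "A \<in> cubic_matrices" "m \<in> X"
    by (elim line_classE)
  have "inf_line (- m) 0 \<in> UnGamma_lines"
    using square_class_zero[OF assms] l(3) by (auto simp: inf_line_in_UnGamma_lines_iff)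
  then show "l \<in> UnGamma_lines"
    unfolding l(1) by (rule cubic_invariantD[OF cubic_invariant_UnGamma_lines l(2)])
qed

lemma UnGamma_lines_eq: "UnGamma_lines = line_class squares \<union> line_class nonsquares"
proof (intro equalityI subsetI)
  fix l :: "'a subsp" assume l: "l \<in> UnGamma_lines"
  then have "card (cubic_points_in l) = 1" by (simp add: UnGamma_lines_def)
  then obtain P where "cubic_points_in l = {P}" by (auto simp: card_1_singleton_iff)
  then have "P \<in> cubic_points_in l" by simp
  then have P: "P \<in> twisted_cubic" "P \<subseteq> l" by (simp_all add: cubic_points_in_def)
  obtain A where A: "A \<in> cubic_matrices" "act A inf_point = P" using cubic_transitive[OF P(1)] .
  define l' where "l' = act (matrix_inv A) l"
  have l_eq: "l = act A l'" by (simp only: l'_def act_matrix_inv[OF A(1)])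
  have "l' \<in> UnGamma_lines"
    unfolding l'_def by (intro cubic_invariantD[OF cubic_invariant_UnGamma_lines] cubic_matrices_inv A l)
  moreover have "inf_point \<subseteq> l'"
    using P(2) act_subset_iff[OF A(1), of inf_point l'] by (simp add: A(2) l_eq)
  ultimately obtain a b where "l' = inf_line a b" "b ^ 2 - a \<noteq> 0" by (rule UnGamma_line_through_inf)
  then have "l' \<in> line_class squares \<or> l' \<in> line_class nonsquares"
    using square_trichotomy[of "b ^ 2 - a"] inf_line_in_line_class by blast
  then show "l \<in> line_class squares \<union> line_class nonsquares"
    unfolding l_eq using cubic_invariantD[OF cubic_invariant_line_class A(1)] by blast
next
  fix l :: "'a subsp" assume "l \<in> line_class squares \<union> line_class nonsquares"
  then show "l \<in> UnGamma_lines"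
    using line_class_subset_UnGamma_lines unfolding square_class_def by blast
qed

text \<open>Two values of \<open>m\<close> in the same class differ by a factor
  \<open>s ^ 2\<close>, so scaling by \<open>s\<close> joins the corresponding normal forms.\<close>

lemma cubic_orbit_eq_line_class:
  assumes X: "square_class X" and "l \<in> line_class X"
  shows "cubic_orbit l = line_class X"
proof
  obtain A m where l: "l = act A (inf_line (- m) 0)" "A \<in> cubic_matrices" "m \<in> X"
    using assms(2) by (elim line_classE)
  have sub: "vec.subspace l" unfolding l(1) by (intro vec_subspace_image vec_subspace_inf_line)
  show "cubic_orbit l \<subseteq> line_class X"
    by (intro cubic_orbit_subset cubic_invariant_line_class assms(2) sub)
  have orb: "cubic_orbit l = cubic_orbit (inf_line (- m) 0)"
    unfolding l(1) by (intro cubic_orbit_act vec_subspace_inf_line l(2))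
  show "line_class X \<subseteq> cubic_orbit l"
  proof
    fix k assume "k \<in> line_class X"
    then obtain B n where k: "k = act B (inf_line (- n) 0)" "B \<in> cubic_matrices" "n \<in> X"
      by (elim line_classE)
    obtain s where s: "s \<noteq> 0" "n = s ^ 2 * m" using square_class_ratio[OF X l(3) k(3)] .
    have "inf_line (- n) 0 = act (scaling_matrix s) (inf_line (- m) 0)"
      unfolding act_scaling_inf_line[OF s(1)] by (simp add: s(2))
    then have "inf_line (- n) 0 \<in> cubic_orbit l"
      unfolding orb using cubic_invariantD[OF cubic_orbit_invariant scaling_in_cubic_matrices[OF s(1)]]
        cubic_orbit_self vec_subspace_inf_line by metis
    then show "k \<in> cubic_orbit l"
      unfolding k(1) by (rule cubic_invariantD[OF cubic_orbit_invariant[OF sub] k(2)])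
  qed
qed

subsection \<open>Planes through a line\<close>

text \<open>One point is \<open>inf_point\<close> itself; the discriminant adds one, two or no
  further points according as it is 0, a nonzero square or a nonsquare.\<close>

lemma pg_plane_in_d_planes_iff:
  "pg_plane 0 1 c m \<in> d_planes 2 \<longleftrightarrow> c ^ 2 = 4 * (m :: 'a)"
  "pg_plane 0 1 c m \<in> d_planes 3 \<longleftrightarrow> c ^ 2 - 4 * (m :: 'a) \<in> squares"
  "pg_plane 0 1 c m \<in> one_bar_planes \<longleftrightarrow> c ^ 2 - 4 * (m :: 'a) \<in> nonsquares"
proof -
  have card: "card (cubic_points_in (pg_plane 0 1 c m)) =
      1 + of_bool (c ^ 2 - 4 * m = 0) + 2 * of_bool (c ^ 2 - 4 * m \<in> squares)"
    using card_quadratic_roots[of c m] by (simp add: card_cubic_points_in_plane)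
  consider "c ^ 2 - 4 * m = 0" | "c ^ 2 - 4 * m \<in> squares" "c ^ 2 - 4 * m \<noteq> 0" "c ^ 2 - 4 * m \<notin> nonsquares"
    | "c ^ 2 - 4 * m \<in> nonsquares" "c ^ 2 - 4 * m \<noteq> 0" "c ^ 2 - 4 * m \<notin> squares"
    using square_trichotomy[of "c ^ 2 - 4 * m"] squares_nonsquares_disjoint zero_notin_squares by metis
  then show "pg_plane 0 1 c m \<in> d_planes 2 \<longleftrightarrow> c ^ 2 = 4 * m"
    "pg_plane 0 1 c m \<in> d_planes 3 \<longleftrightarrow> c ^ 2 - 4 * m \<in> squares"
    "pg_plane 0 1 c m \<in> one_bar_planes \<longleftrightarrow> c ^ 2 - 4 * m \<in> nonsquares"
    by (cases; use card zero_notin_squares in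
      \<open>simp add: d_planes_def one_bar_planes_def pg_plane_in_pg_planes pg_plane_notin_Gamma_planes\<close>)+
qed

lemma pg_plane_0_0_1_in_planes:
  "pg_plane 0 0 1 (m :: 'a) \<in> d_planes 2" "pg_plane 0 0 1 (m :: 'a) \<notin> d_planes 3"
  "pg_plane 0 0 1 (m :: 'a) \<notin> one_bar_planes"
  by (simp_all add: d_planes_def one_bar_planes_def pg_plane_in_pg_planes card_cubic_points_in_plane_0_0_1)

lemma plane_0_0_0_1_notin_planes:
  "pg_plane 0 0 0 (1 :: 'a) \<notin> d_planes 2" "pg_plane 0 0 0 (1 :: 'a) \<notin> d_planes 3"
  "pg_plane 0 0 0 (1 :: 'a) \<notin> one_bar_planes"
  by (simp_all add: d_planes_def one_bar_planes_def card_cubic_points_in_plane_0_0_1 Gamma_planes_eq)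

lemma has_Pi_line_class:
  assumes inv: "cubic_invariant Y" and sub: "Y \<subseteq> pg_planes"
    and count: "\<And>m. m \<in> X \<Longrightarrow> real (card {c. pg_plane 0 1 c m \<in> Y}) + of_bool (pg_plane 0 0 1 0 \<in> Y) = n"
  shows "has_Pi Y (line_class X) n"
  unfolding has_Pi_def
proof
  fix l assume "l \<in> line_class X"
  then obtain A m where l: "l = act A (inf_line (- m) 0)" "A \<in> cubic_matrices" "m \<in> X"
    by (elim line_classE)
  have "card {p \<in> Y. l \<subseteq> p} = card {p \<in> Y. inf_line (- m) 0 \<subseteq> p}"
    unfolding l(1) by (rule card_invariant_planes[OF inv l(2)])
  also have "\<dots> = card {c. pg_plane 0 1 c m \<in> Y} + of_bool (pg_plane 0 0 1 0 \<in> Y)"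
    by (rule card_planes_through_inf_line[OF sub])
  finally show "real (card {p \<in> Y. l \<subseteq> p}) = n" using count[OF l(3)] by simp
qed

lemma d_planes_subset: "d_planes d \<subseteq> pg_planes" "one_bar_planes \<subseteq> pg_planes"
  by (auto simp: d_planes_def one_bar_planes_def)

text \<open>The plane \<open>pg_plane 0 0 1 0\<close> always contributes 1. The others come from the
  solutions of \<open>c ^ 2 = 4 * m\<close>: two if \<open>m\<close> is a nonzero square, none if it
  is a nonsquare.\<close>

lemma has_Pi_d_planes_2:
  "has_Pi (d_planes 2) (line_class squares) 3"
  "has_Pi (d_planes 2) (line_class nonsquares) 1"
proof -
  have "card {c. c ^ 2 = 4 * m} = 2" if "m \<in> squares" for m :: 'a
    using that square_class_four_iff[of squares m] zero_notin_squares
    by (auto simp: card_sqrt square_class_def)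
  then show "has_Pi (d_planes 2) (line_class squares) 3"
    by (intro has_Pi_line_class cubic_invariant_d_planes d_planes_subset)
      (simp add: pg_plane_in_d_planes_iff pg_plane_0_0_1_in_planes)
  have "card {c. c ^ 2 = 4 * m} = 0" if "m \<in> nonsquares" for m :: 'a
  proof -
    have "4 * m \<in> nonsquares" using that square_class_four_iff[of nonsquares m] by (simp add: square_class_def)
    then have "4 * m \<notin> squares" "4 * m \<noteq> 0"
      using squares_nonsquares_disjoint zero_notin_squares by metis+
    then show ?thesis unfolding card_sqrt by simp
  qed
  then show "has_Pi (d_planes 2) (line_class nonsquares) 1"
    by (intro has_Pi_line_class cubic_invariant_d_planes d_planes_subset)
      (simp add: pg_plane_in_d_planes_iff pg_plane_0_0_1_in_planes)
qed

lemma has_Pi_d_planes_3: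
  "has_Pi (d_planes 3) (line_class squares) ((real q - 3) / 2)"
  "has_Pi (d_planes 3) (line_class nonsquares) ((real q - 1) / 2)"
  by (intro has_Pi_line_class cubic_invariant_d_planes d_planes_subset;
    simp add: pg_plane_in_d_planes_iff pg_plane_0_0_1_in_planes card_shifted_squares square_class_four_iff square_class_def)+

lemma has_Pi_one_bar_planes:
  "has_Pi one_bar_planes (line_class squares) ((real q - 1) / 2)"
  "has_Pi one_bar_planes (line_class nonsquares) ((real q + 1) / 2)"
  by (intro has_Pi_line_class cubic_invariant_one_bar_planes d_planes_subset;
    simp add: pg_plane_in_d_planes_iff pg_plane_0_0_1_in_planes card_shifted_squares square_class_four_iff square_class_def)+

lemma line_class_neq_empty:
  assumes "square_class X"
  shows "line_class X \<noteq> {}"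
proof -
  have "real (card X) = (real q - 1) / 2"
    using assms card_squares card_nonsquares unfolding square_class_def by blast
  then have "X \<noteq> {}" using q_ge_5 by auto
  then obtain m where "m \<in> X" by blast
  then have "inf_line (- m) 0 \<in> line_class X" by (intro inf_line_in_line_class) simp
  then show ?thesis by blast
qed

lemma line_class_disjoint: "line_class squares \<inter> line_class nonsquares = {}"
  using has_Pi_d_planes_2 by (fastforce simp: has_Pi_def)

text \<open>Membership in \<open>line_class X\<close> only says that some group element reaches a
  normal form with \<open>m\<close> in \<open>X\<close>. That the value \<open>b ^ 2 - a\<close>
  read off directly has the same class rests on the disjointness of the two classes.\<close>

lemma inf_line_in_line_class_iff:
  assumes "square_class X"
  shows "inf_line a b \<in> line_class X \<longleftrightarrow> b ^ 2 - a \<in> X"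
proof
  assume *: "inf_line a b \<in> line_class X"
  then have "b ^ 2 - a \<noteq> 0"
    using line_class_subset_UnGamma_lines[OF assms] inf_line_in_UnGamma_lines_iff by blast
  then show "b ^ 2 - a \<in> X"
    using * assms square_trichotomy[of "b ^ 2 - a"] inf_line_in_line_class line_class_disjoint
    unfolding square_class_def by blast
qed (rule inf_line_in_line_class)

subsection \<open>Lines in a plane\<close>

text \<open>All coefficients may vanish; \<open>pg_plane 0 0 0 0\<close> is the whole space and
  later yields the number of all such lines at \<open>inf_point\<close>.\<close>

lemma card_line_class_through_inf:
  assumes X: "square_class X"
  shows "card {l \<in> line_class X. inf_point \<subseteq> l \<and> l \<subseteq> pg_plane 0 c1 c2 c3} =
    card {(a, b). b ^ 2 - a \<in> X \<and> c1 * a + c2 * b + c3 = 0}"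
proof -
  have "{l \<in> line_class X. inf_point \<subseteq> l \<and> l \<subseteq> pg_plane 0 c1 c2 c3} =
      (\<lambda>(a, b). inf_line a b) ` {(a, b). b ^ 2 - a \<in> X \<and> c1 * a + c2 * b + c3 = 0}" (is "?L = ?R")
  proof (intro equalityI subsetI)
    fix l assume l: "l \<in> ?L"
    then have "l \<in> UnGamma_lines" "inf_point \<subseteq> l" using line_class_subset_UnGamma_lines[OF X] by auto
    then obtain a b where "l = inf_line a b" by (rule UnGamma_line_through_inf)
    with l show "l \<in> ?R"
      by (auto simp: inf_line_in_line_class_iff[OF X] inf_line_subset_pg_plane)
  next
    fix l assume "l \<in> ?R"
    then obtain a b where "l = inf_line a b" "b ^ 2 - a \<in> X" "c1 * a + c2 * b + c3 = 0" by auto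
    then show "l \<in> ?L"
      by (simp add: inf_line_in_line_class_iff[OF X] inf_line_subset_pg_plane inf_point_subset_inf_line)
  qed
  moreover have "inj_on (\<lambda>(a, b). inf_line a b) S" for S :: "('a \<times> 'a) set"
    by (auto simp: inj_on_def inf_line_eq_iff)
  ultimately show ?thesis by (simp add: card_image)
qed

text \<open>On the plane \<open>a = - (c * b + m)\<close>, so \<open>b ^ 2 - a\<close> is the
  polynomial of the plane evaluated at \<open>b\<close>.\<close>

lemma card_line_class_through_inf_plane_0_1:
  assumes "square_class X"
  shows "card {l \<in> line_class X. inf_point \<subseteq> l \<and> l \<subseteq> pg_plane 0 1 c m} = card {x. x ^ 2 - (c ^ 2 - 4 * m) \<in> X}"
proof -
  have "{(a, b). b ^ 2 - a \<in> X \<and> 1 * a + c * b + m = 0} = (\<lambda>b. (- (c * b + m), b)) ` {b. b ^ 2 + c * b + m \<in> X}"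
  proof (intro equalityI subsetI)
    fix z assume "z \<in> {(a, b). b ^ 2 - a \<in> X \<and> 1 * a + c * b + m = 0}"
    then obtain a b where z: "z = (a, b)" "b ^ 2 - a \<in> X" "a + (c * b + m) = 0" by (auto simp: add.assoc)
    have a: "a = - (c * b + m)" using z(3) by (simp only: eq_neg_iff_add_eq_0)
    then have "b ^ 2 + c * b + m = b ^ 2 - a" by simp
    then have "b ^ 2 + c * b + m \<in> X" using z(2) by (simp only:)
    then show "z \<in> (\<lambda>b. (- (c * b + m), b)) ` {b. b ^ 2 + c * b + m \<in> X}"
      unfolding z(1) a by blast
  qed (auto simp: algebra_simps)
  then have "card {(a, b). b ^ 2 - a \<in> X \<and> 1 * a + c * b + m = 0} = card {b. b ^ 2 + c * b + m \<in> X}"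
    by (simp add: card_image inj_on_def)
  then show ?thesis by (simp only: card_line_class_through_inf[OF assms] card_quadratic_mem[OF assms])
qed

text \<open>Here \<open>b = - m\<close> is fixed and \<open>a\<close> is free, so
  \<open>b ^ 2 - a\<close> takes every field value once.\<close>

lemma card_line_class_through_inf_plane_0_0_1:
  assumes "square_class X"
  shows "real (card {l \<in> line_class X. inf_point \<subseteq> l \<and> l \<subseteq> pg_plane 0 0 1 m}) = (real q - 1) / 2"
proof -
  have "{(a, b). b ^ 2 - a \<in> X \<and> 0 * a + 1 * b + m = 0} = (\<lambda>x. (m ^ 2 - x, - m)) ` X"
  proof (intro equalityI subsetI)
    fix z assume "z \<in> {(a, b). b ^ 2 - a \<in> X \<and> 0 * a + 1 * b + m = 0}"
    then obtain a b where z: "z = (a, b)" "b ^ 2 - a \<in> X" "b + m = 0" by auto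
    have "b = - m" using z(3) by (simp add: eq_neg_iff_add_eq_0)
    then have "z = (m ^ 2 - (b ^ 2 - a), - m)" using z(1) by simp
    then show "z \<in> (\<lambda>x. (m ^ 2 - x, - m)) ` X" using z(2) by (rule image_eqI)
  qed auto
  then have "card {(a, b). b ^ 2 - a \<in> X \<and> 0 * a + 1 * b + m = 0} = card X"
    by (simp add: card_image inj_on_def)
  then show ?thesis unfolding card_line_class_through_inf[OF assms]
    using assms card_squares card_nonsquares unfolding square_class_def by auto
qed

lemma card_line_class_through_inf_all:
  assumes "square_class X"
  shows "real (card {l \<in> line_class X. inf_point \<subseteq> l \<and> l \<subseteq> UNIV}) = real q * (real q - 1) / 2"
proof -
  have "{(a, b). b ^ 2 - a \<in> X \<and> 0 * a + 0 * b + 0 = 0} = (\<lambda>(x, b). (b ^ 2 - x, b)) ` (X \<times> UNIV)"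
  proof (intro equalityI subsetI)
    fix z assume "z \<in> {(a, b). b ^ 2 - a \<in> X \<and> 0 * a + 0 * b + 0 = 0}"
    then obtain a b where z: "z = (a, b)" "b ^ 2 - a \<in> X" by auto
    show "z \<in> (\<lambda>(x, b). (b ^ 2 - x, b)) ` (X \<times> UNIV)"
      by (rule image_eqI[of _ _ "(b ^ 2 - a, b)"]) (use z in auto)
  qed auto
  then have "card {(a, b). b ^ 2 - a \<in> X \<and> 0 * a + 0 * b + 0 = 0} = card (X \<times> (UNIV :: 'a set))"
    by (simp only:) (rule card_image, auto simp: inj_on_def)
  then have "card {l \<in> line_class X. inf_point \<subseteq> l \<and> l \<subseteq> pg_plane 0 0 0 0} = card X * q"
    unfolding card_line_class_through_inf[OF assms] by (simp add: card_cartesian_product)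
  moreover have "pg_plane 0 0 0 0 = (UNIV :: 'a subsp)" by (simp add: pg_plane_def)
  moreover have "real (card X) = (real q - 1) / 2"
    using assms card_squares card_nonsquares unfolding square_class_def by blast
  ultimately show ?thesis by (simp add: mult.commute)
qed

text \<open>Each of the \<open>q + 1\<close> points of the cubic carries \<open>q\<close> choices of
  \<open>b\<close> times \<open>(q - 1) / 2\<close> values of \<open>b ^ 2 - a\<close>.\<close>

lemma card_line_class:
  assumes "square_class X"
  shows "real (card (line_class X)) = (real q ^ 3 - real q) / 2"
proof -
  have "card (line_class X) = (\<Sum>P\<in>cubic_points_in UNIV. card {l \<in> line_class X. P \<subseteq> l \<and> l \<subseteq> UNIV})"
    using card_by_cubic_points[OF line_class_subset_UnGamma_lines[OF assms], of UNIV] by simp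
  then have "real (card (line_class X)) =
      (\<Sum>P\<in>cubic_points_in UNIV. real (card {l \<in> line_class X. P \<subseteq> l \<and> l \<subseteq> UNIV}))" by simp
  also have "\<dots> = (\<Sum>P\<in>cubic_points_in (UNIV :: 'a subsp). real q * (real q - 1) / 2)"
  proof (intro sum.cong refl)
    fix P :: "'a subsp" assume "P \<in> cubic_points_in UNIV"
    then have "P \<in> twisted_cubic" by (simp add: cubic_points_in_def)
    then obtain A where A: "A \<in> cubic_matrices" "act A inf_point = P" by (rule cubic_transitive)
    have "card {l \<in> line_class X. P \<subseteq> l \<and> l \<subseteq> UNIV} = card {l \<in> line_class X. inf_point \<subseteq> l \<and> l \<subseteq> UNIV}"
      by (rule card_invariant_eq[OF cubic_invariant_line_class A(1)])
        (simp add: act_subset_iff[OF A(1)] flip: A(2))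
    then show "real (card {l \<in> line_class X. P \<subseteq> l \<and> l \<subseteq> UNIV}) = real q * (real q - 1) / 2"
      using card_line_class_through_inf_all[OF assms] by simp
  qed
  also have "\<dots> = (real q + 1) * (real q * (real q - 1) / 2)"
    using card_twisted_cubic[where 'a = 'a] by (simp add: cubic_points_in_def)
  finally show ?thesis by (simp add: power3_eq_cube algebra_simps)
qed

text \<open>Each of the \<open>d\<close> cubic points of a plane contributes the same
  \<open>n\<close> once moved to \<open>inf_point\<close>, provided the local count is the same for
  every plane of \<open>Y\<close> through it.\<close>

lemma has_Lambda_line_class:
  assumes X: "square_class X" and inv: "cubic_invariant Y" and sub: "Y \<subseteq> d_planes d"
    and local_count: "\<And>p. p \<in> Y \<Longrightarrow> inf_point \<subseteq> p \<Longrightarrow>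
      real (card {l \<in> line_class X. inf_point \<subseteq> l \<and> l \<subseteq> p}) = n"
  shows "has_Lambda (line_class X) Y (real d * n)"
  unfolding has_Lambda_def
proof
  fix p assume p: "p \<in> Y"
  have "real (card {l \<in> line_class X. l \<subseteq> p}) =
      (\<Sum>P\<in>cubic_points_in p. real (card {l \<in> line_class X. P \<subseteq> l \<and> l \<subseteq> p}))"
    using card_by_cubic_points[OF line_class_subset_UnGamma_lines[OF X], of p] by simp
  also have "\<dots> = (\<Sum>P\<in>cubic_points_in p. n)"
  proof (intro sum.cong refl)
    fix P :: "'a subsp" assume "P \<in> cubic_points_in p"
    then have P: "P \<in> twisted_cubic" "P \<subseteq> p" by (simp_all add: cubic_points_in_def)
    obtain A where A: "A \<in> cubic_matrices" "act A inf_point = P" using cubic_transitive[OF P(1)] .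
    define p' where "p' = act (matrix_inv A) p"
    have p_eq: "p = act A p'" by (simp only: p'_def act_matrix_inv[OF A(1)])
    have "card {l \<in> line_class X. P \<subseteq> l \<and> l \<subseteq> p} = card {l \<in> line_class X. inf_point \<subseteq> l \<and> l \<subseteq> p'}"
      unfolding A(2)[symmetric] p_eq by (rule card_invariant_flags[OF cubic_invariant_line_class A(1)])
    moreover have "p' \<in> Y" unfolding p'_def by (intro cubic_invariantD[OF inv] cubic_matrices_inv A p)
    moreover have "inf_point \<subseteq> p'"
      using P(2) act_subset_iff[OF A(1), of inf_point p'] by (simp add: A(2) p_eq)
    ultimately show "real (card {l \<in> line_class X. P \<subseteq> l \<and> l \<subseteq> p}) = n" using local_count by simp
  qed
  also have "\<dots> = real d * n" using p sub by (auto simp: d_planes_def)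
  finally show "real (card {l \<in> line_class X. l \<subseteq> p}) = real d * n" .
qed

lemma d_planes_3_through_inf:
  assumes "p \<in> d_planes 3" "inf_point \<subseteq> (p :: 'a subsp)"
  obtains c m where "p = pg_plane 0 1 c m" "c ^ 2 - 4 * m \<in> squares"
proof -
  have "p \<in> pg_planes" using assms d_planes_subset by blast
  from this assms(2) show ?thesis
    by (cases rule: plane_through_inf_cases)
      (use assms that pg_plane_0_0_1_in_planes plane_0_0_0_1_notin_planes pg_plane_in_d_planes_iff in metis)+
qed

lemma one_bar_planes_through_inf:
  assumes "p \<in> one_bar_planes" "inf_point \<subseteq> (p :: 'a subsp)"
  obtains c m where "p = pg_plane 0 1 c m" "c ^ 2 - 4 * m \<in> nonsquares"
proof -
  have "p \<in> pg_planes" using assms d_planes_subset by blast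
  from this assms(2) show ?thesis
    by (cases rule: plane_through_inf_cases)
      (use assms that pg_plane_0_0_1_in_planes plane_0_0_0_1_notin_planes pg_plane_in_d_planes_iff in metis)+
qed

lemma square_classI: "square_class squares" "square_class nonsquares"
  by (simp_all add: square_class_def)

lemma has_Lambda_d_planes_3:
  "has_Lambda (line_class squares) (d_planes 3) (3 / 2 * (real q - 3))"
  "has_Lambda (line_class nonsquares) (d_planes 3) (3 / 2 * (real q - 1))"
proof -
  have "has_Lambda (line_class squares) (d_planes 3) (real 3 * ((real q - 3) / 2))"
    by (intro has_Lambda_line_class square_classI cubic_invariant_d_planes order_refl)
      (erule d_planes_3_through_inf, assumption,
        simp add: card_line_class_through_inf_plane_0_1 square_classI card_shifted_squares)
  then show "has_Lambda (line_class squares) (d_planes 3) (3 / 2 * (real q - 3))" by simp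
  have "has_Lambda (line_class nonsquares) (d_planes 3) (real 3 * ((real q - 1) / 2))"
    by (intro has_Lambda_line_class square_classI cubic_invariant_d_planes order_refl)
      (erule d_planes_3_through_inf, assumption,
        simp add: card_line_class_through_inf_plane_0_1 square_classI card_shifted_squares)
  then show "has_Lambda (line_class nonsquares) (d_planes 3) (3 / 2 * (real q - 1))" by simp
qed

lemma has_Lambda_one_bar_planes:
  "has_Lambda (line_class squares) one_bar_planes ((real q - 1) / 2)"
  "has_Lambda (line_class nonsquares) one_bar_planes ((real q + 1) / 2)"
proof -
  have sub: "one_bar_planes \<subseteq> d_planes 1" by (auto simp: one_bar_planes_def d_planes_def)
  have "has_Lambda (line_class squares) one_bar_planes (real 1 * ((real q - 1) / 2))"
    by (intro has_Lambda_line_class square_classI cubic_invariant_one_bar_planes sub)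
      (erule one_bar_planes_through_inf, assumption,
        simp add: card_line_class_through_inf_plane_0_1 square_classI card_shifted_squares)
  then show "has_Lambda (line_class squares) one_bar_planes ((real q - 1) / 2)" by simp
  have "has_Lambda (line_class nonsquares) one_bar_planes (real 1 * ((real q + 1) / 2))"
    by (intro has_Lambda_line_class square_classI cubic_invariant_one_bar_planes sub)
      (erule one_bar_planes_through_inf, assumption,
        simp add: card_line_class_through_inf_plane_0_1 square_classI card_shifted_squares)
  then show "has_Lambda (line_class nonsquares) one_bar_planes ((real q + 1) / 2)" by simp
qed

section \<open>Lines in the planes with two points of the cubic\<close>

lemma act_translation_pg_plane_0_1:
  "act (translation_matrix (c / 2)) (pg_plane 0 1 c ((c / 2) ^ 2)) = pg_plane 0 1 0 (0 :: 'a)"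
proof (rule act_eqI[OF translation_in_cubic_matrices vec_subspace_pg_plane vec_subspace_pg_plane])
  show "translation_matrix (c / 2) *v x \<in> pg_plane 0 1 0 0" if "x \<in> pg_plane 0 1 c ((c / 2) ^ 2)" for x
    using that two_neq_0 by (simp add: pg_plane_def translation_matrix_mult)
qed (simp add: vec_dim_pg_plane)

lemma act_translation_pg_plane_0_0_1:
  "act (translation_matrix m) (pg_plane 0 0 1 m) = pg_plane 0 0 1 (0 :: 'a)"
proof (rule act_eqI[OF translation_in_cubic_matrices vec_subspace_pg_plane vec_subspace_pg_plane])
  show "translation_matrix m *v x \<in> pg_plane 0 0 1 0" if "x \<in> pg_plane 0 0 1 m" for x
    using that by (simp add: pg_plane_def translation_matrix_mult)
qed (simp add: vec_dim_pg_plane)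

text \<open>Through \<open>inf_point\<close> such a plane contains the tangent either there (linear
  polynomial) or at its other point (double root). A translation moves the other point to parameter
  0, and inversion turns the second kind into the first.\<close>

lemma d_planes_2_transitive:
  assumes "p \<in> d_planes 2"
  obtains A where "A \<in> cubic_matrices" "p = act A (pg_plane 0 0 1 (0 :: 'a))"
proof -
  have norm: "\<exists>B\<in>cubic_matrices. act B r = pg_plane 0 0 1 0"
    if r: "r \<in> d_planes 2" "inf_point \<subseteq> r" for r :: "'a subsp"
  proof -
    have "r \<in> pg_planes" using r(1) d_planes_subset by blast
    from this r(2) show ?thesis
    proof (cases rule: plane_through_inf_cases)
      case (1 c m)
      then have "c ^ 2 = 4 * m" using r(1) pg_plane_in_d_planes_iff by blast
      then have m: "m = (c / 2) ^ 2" using four_neq_0 by (simp add: power_divide)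
      have "act (inversion_matrix ** translation_matrix (c / 2)) r = pg_plane 0 0 1 0"
        unfolding act_act[symmetric] 1 m act_translation_pg_plane_0_1
        by (subst act_inversion_pg_plane) auto
      then show ?thesis
        using cubic_matrices_mult[OF inversion_in_cubic_matrices translation_in_cubic_matrices] by blast
    next
      case (2 m)
      then show ?thesis using act_translation_pg_plane_0_0_1 translation_in_cubic_matrices by blast
    next
      case 3
      then show ?thesis using r(1) plane_0_0_0_1_notin_planes by blast
    qed
  qed
  have "card (cubic_points_in p) = 2" using assms by (simp add: d_planes_def)
  then have "cubic_points_in p \<noteq> {}" by auto
  then obtain P where P: "P \<in> twisted_cubic" "P \<subseteq> p" by (auto simp: cubic_points_in_def)
  obtain A where A: "A \<in> cubic_matrices" "act A inf_point = P" using cubic_transitive[OF P(1)] .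
  define p' where "p' = act (matrix_inv A) p"
  have p_eq: "p = act A p'" by (simp only: p'_def act_matrix_inv[OF A(1)])
  have "p' \<in> d_planes 2"
    unfolding p'_def by (intro cubic_invariantD[OF cubic_invariant_d_planes] cubic_matrices_inv A assms)
  moreover have "inf_point \<subseteq> p'"
    using P(2) act_subset_iff[OF A(1), of inf_point p'] by (simp add: A(2) p_eq)
  ultimately obtain B where B: "B \<in> cubic_matrices" "act B p' = pg_plane 0 0 1 0" using norm by blast
  have "act (A ** matrix_inv B) (pg_plane 0 0 1 0) = p"
    unfolding act_act[symmetric] B(2)[symmetric] act_matrix_inv[OF B(1)] p_eq ..
  then show ?thesis
    using that[of "A ** matrix_inv B"] cubic_matrices_mult[OF A(1) cubic_matrices_inv[OF B(1)]] by simp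
qed

text \<open>The two points of a plane of this kind behave differently: the plane contains the tangent
  at one of them only.\<close>

lemma has_Lambda_d_planes_2_sum:
  assumes X: "square_class X"
  shows "has_Lambda (line_class X) (d_planes 2) ((real q - 1) / 2 + real (card {x. x ^ 2 \<in> X}))"
  unfolding has_Lambda_def
proof
  let ?p = "pg_plane 0 0 1 0 :: 'a subsp"
  fix p :: "'a subsp" assume "p \<in> d_planes 2"
  then obtain A where A: "A \<in> cubic_matrices" "p = act A ?p" by (rule d_planes_2_transitive)
  have "card {l \<in> line_class X. l \<subseteq> p} = card {l \<in> line_class X. l \<subseteq> ?p}"
    unfolding A(2) by (rule card_invariant_eq[OF cubic_invariant_line_class A(1)]) (simp add: act_subset_iff[OF A(1)])
  also have "\<dots> = (\<Sum>P\<in>cubic_points_in ?p. card {l \<in> line_class X. P \<subseteq> l \<and> l \<subseteq> ?p})"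
    by (rule card_by_cubic_points[OF line_class_subset_UnGamma_lines[OF X]])
  also have "cubic_points_in ?p = {inf_point, cubic_point 0}"
  proof (intro equalityI subsetI)
    fix P assume "P \<in> cubic_points_in ?p"
    then show "P \<in> {inf_point, cubic_point 0}"
      by (auto simp: cubic_points_in_def twisted_cubic_eq cubic_point_subset_pg_plane)
  next
    fix P assume "P \<in> {inf_point, cubic_point 0 :: 'a subsp}"
    then show "P \<in> cubic_points_in ?p"
      by (elim insertE emptyE; simp add: cubic_points_in_def twisted_cubic_eq
          inf_point_subset_pg_plane cubic_point_subset_pg_plane)
  qed
  also have "(\<Sum>P\<in>\<dots>. card {l \<in> line_class X. P \<subseteq> l \<and> l \<subseteq> ?p}) =
      card {l \<in> line_class X. inf_point \<subseteq> l \<and> l \<subseteq> ?p} + card {l \<in> line_class X. cubic_point 0 \<subseteq> l \<and> l \<subseteq> ?p}"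
    by (simp add: inf_point_neq_cubic_point)
  \<comment> \<open>Inversion brings the second point to \<open>inf_point\<close> and the plane to
    the one with polynomial \<open>t ^ 2\<close>, whose discriminant is 0.\<close>
  also have "card {l \<in> line_class X. cubic_point 0 \<subseteq> l \<and> l \<subseteq> ?p} =
      card {l \<in> line_class X. inf_point \<subseteq> l \<and> l \<subseteq> pg_plane 0 1 0 0}"
    using card_invariant_flags[OF cubic_invariant_line_class inversion_in_cubic_matrices, of X inf_point "pg_plane 0 1 0 0"]
    by (simp add: act_inversion_inf act_inversion_pg_plane)
  also have "\<dots> = card {x. x ^ 2 \<in> X}"
    using card_line_class_through_inf_plane_0_1[OF X, of 0 0] by simp
  finally show "real (card {l \<in> line_class X. l \<subseteq> p}) = (real q - 1) / 2 + real (card {x. x ^ 2 \<in> X})"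
    using card_line_class_through_inf_plane_0_0_1[OF X, of 0] by simp
qed

text \<open>The point where the plane contains the tangent gives \<open>(q - 1) / 2\<close> lines of
  either class. At the other point the class is that of \<open>x ^ 2\<close>: \<open>q - 1\<close>
  lines for \<open>squares\<close> and none for \<open>nonsquares\<close>.\<close>

lemma has_Lambda_d_planes_2:
  "has_Lambda (line_class squares) (d_planes 2) (3 / 2 * (real q - 1))"
  "has_Lambda (line_class nonsquares) (d_planes 2) ((real q - 1) / 2)"
proof -
  have "(real q - 1) / 2 + (real q - 1) = 3 / 2 * (real q - 1)" by (simp add: field_simps)
  then show "has_Lambda (line_class squares) (d_planes 2) (3 / 2 * (real q - 1))"
    using has_Lambda_d_planes_2_sum[of squares] unfolding card_square_mem
    by (simp only: square_classI simp_thms)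
  show "has_Lambda (line_class nonsquares) (d_planes 2) ((real q - 1) / 2)"
    using has_Lambda_d_planes_2_sum[of nonsquares] unfolding card_square_mem
    by (simp add: square_classI)
qed

section \<open>The zero entries and the list of orbits\<close>

lemma has_Pi_has_Lambda_zero:
  fixes X Y :: "'a subsp set"
  assumes "\<And>l p. l \<in> X \<Longrightarrow> p \<in> Y \<Longrightarrow> \<not> l \<subseteq> p"
  shows "has_Pi Y X 0" "has_Lambda X Y 0"
proof -
  have "{p \<in> Y. l \<subseteq> p} = {}" if "l \<in> X" for l using assms that by blast
  then show "has_Pi Y X 0" by (simp add: has_Pi_def)
  have "{l \<in> X. l \<subseteq> p} = {}" if "p \<in> Y" for p using assms that by blast
  then show "has_Lambda X Y 0" by (simp add: has_Lambda_def)
qed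

lemma UnGamma_line_not_in_0_plane:
  assumes "l \<in> UnGamma_lines" "p \<in> d_planes 0"
  shows "\<not> l \<subseteq> (p :: 'a subsp)"
proof
  assume "l \<subseteq> p"
  then have "cubic_points_in l \<subseteq> cubic_points_in p" by (auto simp: cubic_points_in_def)
  moreover have "cubic_points_in p = {}" using assms(2) by (simp add: d_planes_def)
  ultimately show False using assms(1) by (simp add: UnGamma_lines_def)
qed

lemma orbits_of_UnGamma_lines:
  "cubic_orbit ` UnGamma_lines = {line_class nonsquares, line_class squares :: 'a subsp set}"
proof
  show "cubic_orbit ` UnGamma_lines \<subseteq> {line_class nonsquares, line_class squares :: 'a subsp set}"
    using cubic_orbit_eq_line_class square_classI unfolding UnGamma_lines_eq by blast
  have "line_class X \<in> cubic_orbit ` UnGamma_lines" if X: "square_class X" for X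
  proof -
    obtain l where l: "l \<in> line_class X" using line_class_neq_empty[OF X] by blast
    then have "l \<in> UnGamma_lines" using line_class_subset_UnGamma_lines[OF X] by blast
    then show ?thesis using cubic_orbit_eq_line_class[OF X l] by blast
  qed
  then show "{line_class nonsquares, line_class squares} \<subseteq> cubic_orbit ` UnGamma_lines"
    using square_classI by blast
qed

end

theorem theorem7p4:
  fixes q :: nat
  assumes "q = CARD('a::{field,finite})" and "odd q" and "q \<ge> 5"
  shows "\<exists>O1 O2 :: 'a subsp set.
    cubic_orbit ` UnGamma_lines = {O1, O2} \<and> O1 \<noteq> O2 \<and>
    real (card O1) = (real q ^ 3 - real q) / 2 \<and>
    real (card O2) = (real q ^ 3 - real q) / 2 \<and>
    has_Pi Gamma_planes O1 0 \<and> has_Lambda O1 Gamma_planes 0 \<and>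
    has_Pi Gamma_planes O2 0 \<and> has_Lambda O2 Gamma_planes 0 \<and>
    has_Pi (d_planes 0) O1 0 \<and> has_Lambda O1 (d_planes 0) 0 \<and>
    has_Pi (d_planes 0) O2 0 \<and> has_Lambda O2 (d_planes 0) 0 \<and>
    has_Pi (d_planes 2) O1 1 \<and>
    has_Pi (d_planes 2) O2 3 \<and>
    has_Lambda O1 (d_planes 2) ((real q - 1) / 2) \<and>
    has_Pi (d_planes 3) O1 ((real q - 1) / 2) \<and>
    has_Pi one_bar_planes O2 ((real q - 1) / 2) \<and>
    has_Lambda O2 one_bar_planes ((real q - 1) / 2) \<and>
    has_Pi (d_planes 3) O2 ((real q - 3) / 2) \<and>
    has_Lambda O2 (d_planes 3) (3 / 2 * (real q - 3)) \<and>
    has_Lambda O2 (d_planes 2) (3 / 2 * (real q - 1)) \<and>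
    has_Lambda O1 (d_planes 3) (3 / 2 * (real q - 1)) \<and>
    has_Pi one_bar_planes O1 ((real q + 1) / 2) \<and>
    has_Lambda O1 one_bar_planes ((real q + 1) / 2)"
proof -
  interpret odd_order_field "TYPE('a)" q
    using assms by unfold_locales auto
  have not_Gamma: "\<not> l \<subseteq> p" if "l \<in> line_class X" "square_class X" "p \<in> Gamma_planes" for l p X
    using that line_class_subset_UnGamma_lines by (auto simp: UnGamma_lines_def)
  have not_0: "\<not> l \<subseteq> p" if "l \<in> line_class X" "square_class X" "p \<in> d_planes 0" for l p X
    using that line_class_subset_UnGamma_lines UnGamma_line_not_in_0_plane by blast
  have "line_class nonsquares \<noteq> line_class squares"
    using line_class_disjoint line_class_neq_empty[OF square_classI(1)] by blast
  \<comment> \<open>The nonsquare class comes first because its lines lie in a single plane with two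
    points of the cubic.\<close>
  then show ?thesis
    by (intro exI[of _ "line_class nonsquares"] exI[of _ "line_class squares"] conjI
        orbits_of_UnGamma_lines card_line_class square_classI
        has_Pi_has_Lambda_zero has_Pi_d_planes_2 has_Pi_d_planes_3 has_Pi_one_bar_planes
        has_Lambda_d_planes_2 has_Lambda_d_planes_3 has_Lambda_one_bar_planes)
      (use not_Gamma not_0 square_classI in blast)+
qed

end
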